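(* Assume $n(k_0)=1$. When $\delta\to0$ (or $\delta\to\infty$), the scattering problem $(\mathrm{SP}_\delta)$ has a unique resonance $\omega(\delta)$ in a neighbourhood of $k_0v$, which is an analytic function of $\delta$ (or $\delta^{-1}$, respectively) with the first-order asymptotics: as $\delta\to0$, $$\omega(\delta)=k_0v+\begin{cases}\dfrac{\cot(s_1k_0)-i}{r^2\ell_1}v\delta+O(\delta^2), & \pi\mid r\ell_1k_0,\\[2mm] \dfrac{\cot(s_{N-1}k_0)-i}{r^2\ell_N}v\delta+O(\delta^2), & \pi\mid r\ell_Nk_0,\\[2mm] \dfrac{\cot(s_{j-1}k_0)+\cot(s_jk_0)}{r^2\ell_j}v\delta+O(\delta^2), & \pi\mid r\ell_jk_0,\ 1<j<N,\\[2mm] \dfrac{\cot(r\ell_jk_0)+\cot(r\ell_{j+1}k_0)}{rs_j}v\delta+O(\delta^2), & \pi\mid s_jk_0,\ 1\le j\le N-1,\end{cases}$$ and as $\delta\to\infty$, $$\omega(\delta)=k_0v+\begin{cases}\dfrac{\cot(s_1k_0)-i}{\ell_1}\dfrac v\delta+O(\delta^{-2}), & \pi\mid r\ell_1k_0,\\[2mm] \dfrac{\cot(s_{N-1}k_0)-i}{\ell_N}\dfrac v\delta+O(\delta^{-2}), & \pi\mid r\ell_Nk_0,\\[2mm] \dfrac{\cot(s_{j-1}k_0)+\cot(s_jk_0)}{\ell_j}\dfrac v\delta+O(\delta^{-2}), & \pi\mid r\ell_jk_0,\ 1<j<N,\\[2mm] \dfrac{\cot(r\ell_jk_0)+\cot(r\ell_{j+1}k_0)}{s_j}\dfrac{vr}\delta+O(\delta^{-2}),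 & \pi\mid s_jk_0,\ 1\le j\le N-1.\end{cases}$$
   Context: Setting. There are $N$ resonators $(x_j^-,x_j^+)\subset\mathbb{R}$, $1\le j\le N$, with $x_j^-<x_j^+<x_{j+1}^-$; $D=\bigcup_{j=1}^N(x_j^-,x_j^+)$, $\ell_j=x_j^+-x_j^-$, $s_j=x_{j+1}^--x_j^+$. $v$ and $v_b$ are the wave speeds outside and inside $D$, $r=v/v_b$ is a fixed positive constant, and $\delta\in\mathbb{C}$ is the density ratio. For $\omega\in\mathbb{C}$ put $k=\omega/v$ and $k_b=\omega/v_b=rk$. $w|_\pm(x)=\lim_{s\to0^+}w(x\pm s)$. The scattering problem $(\mathrm{SP}_\delta)$ is: $u''+k^2u=0$ on $\mathbb{R}\setminus D$; $u''+k_b^2u=0$ on $D$; for all $1\le j\le N$: $u|_+(x_j^\pm)=u|_-(x_j^\pm)$, $u'|_+(x_j^-)=\delta\,u'|_-(x_j^-)$, $u'|_-(x_j^+)=\delta\,u'|_+(x_j^+)$; and $\left(\frac{d}{d|x|}-ik\right)u=0$ for $x\in(-\infty,x_1^-)\cup(x_N^+,+\infty)$. $\omega$ is a resonance (resonant frequency) if this problem has a non-trivial solution $u$. $\boldsymbol t=(t_1,\dots,t_{2N-1})=(r\ell_1,s_1,r\ell_2,s_2,\dots,r\ell_{N-1},s_{N-1},r\ell_N)\in\mathbb{R}_{>0}^{2N-1}$. For $k\in E=\bigcup_{j=1}^{2N-1}(\pi\mathbb{Z}/t_j)$, $n(k)=\#\{j:1\le j\le 2N-1,\ t_jk\in\pi\mathbb{Z}\}$.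 The notation $\pi\mid x$ means $x\in\pi\mathbb{Z}$.
   Formalization: For N=1 the case k_0=0 is excluded (there ω=0 is a second resonance for every δ, so uniqueness fails), and the formulas with s_1 and s_{N-1} are asserted only for N≥2, since these gaps do not exist when N=1. *)

theory Defs
  imports "HOL-Analysis.Analysis" "HOL-Library.Landau_Symbols"
begin

text \<open>
  The end points of the resonators are given by two functions \<open>xm, xp :: nat \<Rightarrow> real\<close>, of which only
  the values \<open>xm j\<close> (standing for $x_j^-$) and \<open>xp j\<close> (for $x_j^+$) with \<open>1 \<le> j \<le> N\<close> are used.
\<close>

definition resonators :: "nat \<Rightarrow> (nat \<Rightarrow> real) \<Rightarrow> (nat \<Rightarrow> real) \<Rightarrow> real set" where
  "resonators N xm xp = (\<Union>j\<in>{1..N}. {xm j <..< xp j})"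

definition len :: "(nat \<Rightarrow> real) \<Rightarrow> (nat \<Rightarrow> real) \<Rightarrow> nat \<Rightarrow> real" where
  "len xm xp j = xp j - xm j"

definition gap :: "(nat \<Rightarrow> real) \<Rightarrow> (nat \<Rightarrow> real) \<Rightarrow> nat \<Rightarrow> real" where
  "gap xm xp j = xm (j + 1) - xp j"

definition has_traces :: "(real \<Rightarrow> complex) \<Rightarrow> real \<Rightarrow> complex \<Rightarrow> complex \<Rightarrow> bool" where
  "has_traces w p a b \<longleftrightarrow> (w \<longlongrightarrow> a) (at_left p) \<and> (w \<longlongrightarrow> b) (at_right p)"

text \<open>
  The function \<open>u'\<close> is the derivative of \<open>u\<close> away from the end points of the resonators; at the end
  points only its one-sided limits matter. The equation on $\mathbb{R} \setminus D$ is imposed in the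
  interior of that set, the behaviour at the end points being described by the transmission
  conditions. The common one-sided limit of \<open>u\<close> at an end point is required to be the value of \<open>u\<close>
  there: otherwise that value would be arbitrary, and a function vanishing everywhere except at an
  end point would count as a non-trivial solution. In the radiation condition $d/d|x|$ is the
  derivative in the outward direction, that is $-d/dx$ to the left of all resonators and $d/dx$ to
  their right.
\<close>

definition SP_solution ::
  "nat \<Rightarrow> (nat \<Rightarrow> real) \<Rightarrow> (nat \<Rightarrow> real) \<Rightarrow> real \<Rightarrow> real \<Rightarrow> complex \<Rightarrow> complex \<Rightarrow> (real \<Rightarrow> complex) \<Rightarrow> bool"
where
  "SP_solution N xm xp v vb \<delta> \<omega> u \<longleftrightarrow>
    (let D = resonators N xm xp;
         k = \<omega> / of_real v;
         kb = \<omega> / of_real vb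
     in \<exists>u'.
       (\<forall>x \<in> D \<union> - closure D. (u has_vector_derivative u' x) (at x)) \<and>
       (\<forall>x \<in> - closure D. (u' has_vector_derivative - (k\<^sup>2 * u x)) (at x)) \<and>
       (\<forall>x \<in> D. (u' has_vector_derivative - (kb\<^sup>2 * u x)) (at x)) \<and>
       (\<forall>j \<in> {1..N}.
          has_traces u (xm j) (u (xm j)) (u (xm j)) \<and>
          has_traces u (xp j) (u (xp j)) (u (xp j)) \<and>
          (\<exists>a. has_traces u' (xm j) a (\<delta> * a)) \<and>
          (\<exists>a. has_traces u' (xp j) (\<delta> * a) a)) \<and>
       (\<forall>x < xm 1. - u' x - \<i> * k * u x = 0) \<and>
       (\<forall>x > xp N. u' x - \<i> * k * u x = 0))"

definition resonance ::
  "nat \<Rightarrow> (nat \<Rightarrow> real) \<Rightarrow> (nat \<Rightarrow> real) \<Rightarrow> real \<Rightarrow> real \<Rightarrow> complex \<Rightarrow> complex \<Rightarrow> bool"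
where
  "resonance N xm xp v vb \<delta> \<omega> \<longleftrightarrow> (\<exists>u. SP_solution N xm xp v vb \<delta> \<omega> u \<and> u \<noteq> (\<lambda>x. 0))"

definition pi_dvd :: "real \<Rightarrow> bool" where
  "pi_dvd x \<longleftrightarrow> (\<exists>m::int. x = pi * of_int m)"

text \<open>The entries of $(r\ell_1, s_1, r\ell_2, \dots, s_{N-1}, r\ell_N)$, numbered from 1.\<close>

definition tvec :: "real \<Rightarrow> (nat \<Rightarrow> real) \<Rightarrow> (nat \<Rightarrow> real) \<Rightarrow> nat \<Rightarrow> real" where
  "tvec r xm xp i =
     (if odd i then r * len xm xp ((i + 1) div 2) else gap xm xp (i div 2))"

definition nres :: "nat \<Rightarrow> real \<Rightarrow> (nat \<Rightarrow> real) \<Rightarrow> (nat \<Rightarrow> real) \<Rightarrow> real \<Rightarrow> nat" where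
  "nres N r xm xp k = card {i \<in> {1..2 * N - 1}. pi_dvd (tvec r xm xp i * k)}"

end

theory Submission
  imports Defs "HOL-Complex_Analysis.Complex_Analysis"
begin

text \<open>
  The scattering problem is one-dimensional: on each of the \<open>2 * N - 1\<close> bounded intervals and the two
  unbounded ones a solution is a combination of two waves, and the conditions at the end points are
  linear relations between their amplitudes. Choose the amplitudes \<open>u\<close> and \<open>u' / (\<i> * \<kappa>)\<close>, where \<open>\<kappa>\<close>
  is the local wave number, and let \<open>\<epsilon> = \<delta> / r\<close>. Then for \<open>k \<noteq> 0\<close> the frequency \<open>v * k\<close> is a
  resonance if and only if \<open>F k \<epsilon> = 0\<close>, where \<open>F k\<close> is an explicit polynomial in \<open>\<epsilon>\<close> whose
  coefficients are entire functions of \<open>k\<close> (\<open>charpoly\<close>, \<open>resonance_iff_charpoly_zero\<close>). This includes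
  \<open>\<delta> = 0\<close>, where the intervals decouple.

  The polynomial has three properties that yield the theorem. Its constant coefficient is the product of
  the \<open>\<i> * sin (t j * k)\<close> over all intervals (\<open>coeff_charpoly_0\<close>). It thus has a simple zero at
  \<open>k0\<close> if exactly one \<open>t m * k0\<close> is a multiple of \<open>pi\<close>. At such a zero its coefficient of
  \<open>\<epsilon>\<close> reduces to the sum of the cotangents of the two neighbouring intervals times a product
  that cancels against the derivative of the constant coefficient
  (\<open>coeff_charpoly_1_at_zero\<close>); an unbounded interval counts with cotangent \<open>- \<i>\<close>. Finally,
  \<open>F k (1 / \<epsilon>)\<close> and \<open>F k \<epsilon>\<close> have the same zeros \<open>k\<close> (\<open>charpoly_inverse_zero_iff\<close>).

  Near a simple zero the equation \<open>F k \<epsilon> = 0\<close> can be written as \<open>k = k0 - \<epsilon> * M k \<epsilon>\<close>. The contraction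
  principle gives a unique solution \<open>k\<close>, and as a uniform limit of holomorphic iterates it is
  holomorphic in \<open>\<epsilon>\<close> (\<open>analytic_fixed_point\<close>). Its slope at \<open>\<epsilon> = 0\<close> is the sum of the two
  neighbouring cotangents divided by \<open>t m\<close> (\<open>charpoly_root_branch\<close>). By the duality between
  \<open>\<epsilon>\<close> and \<open>1 / \<epsilon>\<close> the same branch describes the limit \<open>\<delta> \<longrightarrow> \<infinity>\<close>, with
  \<open>\<delta> / r\<close> replaced by \<open>r / \<delta>\<close>. This is why the two families of expansions differ only in powers
  of \<open>r\<close>.
\<close>

section \<open>The characteristic polynomial of a chain of intervals\<close>

text \<open>
  Inside an interval of local wave number \<open>\<kappa>\<close> the state is described by \<open>u\<close> and \<open>u' / (\<i> * \<kappa>)\<close>.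
  With this factor \<open>\<i>\<close> the transfer across an interval of phase \<open>\<theta>\<close> is the symmetric matrix with
  diagonal entries \<open>cos \<theta>\<close> and off-diagonal entries \<open>\<i> * sin \<theta>\<close>, which commutes with exchanging
  the two components. Write \<open>lead\<close> for \<open>u\<close> in a resonator and for \<open>u' / (\<i> * \<kappa>)\<close> in the background,
  and \<open>trail\<close> for the other component. The flux condition then multiplies by the contrast \<open>\<epsilon>\<close> in the
  same way at both kinds of end points, after clearing one denominator on leaving a resonator. The
  two polynomials in \<open>\<epsilon>\<close> below are this state at the left end of interval \<open>n + 1\<close>; the initial
  values express an outgoing wave on the left with \<open>u = 1\<close> at the first end point.
\<close>

fun lead trail :: "(nat \<Rightarrow> complex) \<Rightarrow> nat \<Rightarrow> complex poly" where
  "lead \<theta> 0 = 1"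
| "trail \<theta> 0 = [:0, -1:]"
| "lead \<theta> (Suc n) =
     smult (\<i> * sin (\<theta> (Suc n))) (lead \<theta> n) + smult (cos (\<theta> (Suc n))) (trail \<theta> n)"
| "trail \<theta> (Suc n) =
     pCons 0 (smult (cos (\<theta> (Suc n))) (lead \<theta> n) + smult (\<i> * sin (\<theta> (Suc n))) (trail \<theta> n))"

text \<open>
  To the right of the chain an outgoing wave has \<open>u' / (\<i> * \<kappa>) = u\<close>, so after an odd number \<open>n\<close> of
  intervals a nonzero state can be continued by an outgoing wave exactly if \<open>lead\<close> and \<open>trail\<close> agree.
\<close>

definition charpoly :: "(nat \<Rightarrow> complex) \<Rightarrow> nat \<Rightarrow> complex poly" where
  "charpoly \<theta> n = lead \<theta> n - trail \<theta> n"

lemma coeff_trail_0: "coeff (trail \<theta> n) 0 = 0"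
  by (cases n) auto

lemma coeff_lead_0: "coeff (lead \<theta> n) 0 = (\<Prod>j=1..n. \<i> * sin (\<theta> j))"
  by (induction n) (simp_all add: coeff_trail_0 prod.cl_ivl_Suc)

lemma coeff_charpoly_0: "coeff (charpoly \<theta> n) 0 = (\<Prod>j=1..n. \<i> * sin (\<theta> j))"
  by (simp add: charpoly_def coeff_trail_0 coeff_lead_0)

text \<open>
  An unbounded exterior interval carries a single outgoing wave. It takes part in the formulas as an
  interval whose cotangent is \<open>- \<i>\<close>.
\<close>

definition side_cot :: "(nat \<Rightarrow> complex) \<Rightarrow> nat \<Rightarrow> nat \<Rightarrow> complex" where
  "side_cot \<theta> n j = (if j = 0 \<or> j = Suc n then - \<i> else cos (\<theta> j) / sin (\<theta> j))"

text \<open>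
  The coefficient of \<open>\<epsilon>\<close> is a sum over pairs of adjacent intervals, in which both factors \<open>\<i> * sin\<close> of
  the constant coefficient are replaced by \<open>cos\<close>; the unbounded intervals also form pairs with
  their neighbours. If \<open>sin (\<theta> m)\<close> vanishes, only the two pairs survive that contain \<open>m\<close>. The
  contribution of the left neighbour is already present in the state that leaves interval \<open>m\<close>,
  that of the right neighbour arises one interval later, and from then on the state is only multiplied by \<open>\<i> * sin\<close>.
\<close>

lemma coeff_charpoly_1_at_zero:
  assumes m: "1 \<le> m" "m \<le> n" and zero: "sin (\<theta> m) = 0"
    and nz: "\<And>j. 1 \<le> j \<Longrightarrow> j \<le> n \<Longrightarrow> j \<noteq> m \<Longrightarrow> sin (\<theta> j) \<noteq> 0"
  shows "\<i> * coeff (charpoly \<theta> n) 1 =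
    cos (\<theta> m) * (\<Prod>j\<in>{1..n} - {m}. \<i> * sin (\<theta> j)) * (side_cot \<theta> n (m - 1) + side_cot \<theta> n (m + 1))"
proof -
  obtain q where q: "m = Suc q" using m by (cases m) auto
  define x where "x = (\<Prod>j=1..q. \<i> * sin (\<theta> j))"
  have trail_q: "\<i> * coeff (trail \<theta> q) 1 = side_cot \<theta> n q * x"
  proof (cases q)
    case (Suc q')
    then have "sin (\<theta> q) \<noteq> 0" using nz[of q] q m by auto
    moreover have "q \<noteq> Suc n" using q m by simp
    ultimately show ?thesis using Suc
      by (simp add: side_cot_def x_def coeff_trail_0 coeff_lead_0 prod.cl_ivl_Suc field_simps)
  qed (simp add: side_cot_def x_def)
  have lead_m: "\<i> * coeff (lead \<theta> m) 1 = cos (\<theta> m) * (side_cot \<theta> n q * x)"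
    using zero trail_q by (simp add: q algebra_simps)
  have trail_m: "coeff (trail \<theta> m) 1 = cos (\<theta> m) * x"
    using zero by (simp add: q x_def coeff_trail_0 coeff_lead_0)
  have lead_0: "coeff (lead \<theta> i) 0 = 0" if "m \<le> i" for i
    unfolding coeff_lead_0 using m zero that by (intro prod_zero) auto
  show ?thesis
  proof (cases "m = n")
    case True
    have "{1..n} - {m} = {1..q}" using True q by auto
    moreover have "m - 1 = q" "side_cot \<theta> n (m + 1) = - \<i>" using True q by (auto simp: side_cot_def)
    ultimately show ?thesis using lead_m trail_m unfolding True
      by (simp add: charpoly_def x_def algebra_simps)
  next
    case False
    have tail: "\<i> * coeff (lead \<theta> (Suc m + d)) 1 =
        cos (\<theta> m) * (\<Prod>j\<in>{1..Suc m + d} - {m}. \<i> * sin (\<theta> j)) * (side_cot \<theta> n q + side_cot \<theta> n (m + 1))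
        \<and> coeff (trail \<theta> (Suc m + d)) 1 = 0" if "Suc m + d \<le> n" for d
      using that
    proof (induction d)
      case 0
      have s: "sin (\<theta> (Suc m)) \<noteq> 0" using nz[of "Suc m"] 0 by simp
      have "{1..Suc m + 0} - {m} = insert (Suc m) {1..q}" using q by auto
      then have P: "(\<Prod>j\<in>{1..Suc m + 0} - {m}. \<i> * sin (\<theta> j)) = \<i> * sin (\<theta> (Suc m)) * x"
        using q by (simp add: x_def)
      have c: "side_cot \<theta> n (m + 1) = cos (\<theta> (Suc m)) / sin (\<theta> (Suc m))"
        using 0 by (simp add: side_cot_def)
      have t: "coeff (trail \<theta> (Suc m)) 1 = 0"
        by (simp add: coeff_trail_0 lead_0)
      have "\<i> * coeff (lead \<theta> (Suc m)) 1 = \<i> * sin (\<theta> (Suc m)) * (\<i> * coeff (lead \<theta> m) 1)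
              + \<i> * cos (\<theta> (Suc m)) * coeff (trail \<theta> m) 1"
        by (simp add: algebra_simps)
      also have "\<dots> = cos (\<theta> m) * (\<i> * sin (\<theta> (Suc m)) * x) * (side_cot \<theta> n q + side_cot \<theta> n (m + 1))"
        unfolding lead_m trail_m c using s by (simp add: field_simps)
      finally show ?case using P t by simp
    next
      case (Suc d)
      define p where "p = Suc m + d"
      have "coeff (lead \<theta> p) 0 = 0" by (rule lead_0) (simp add: p_def)
      moreover have "{1..Suc p} - {m} = insert (Suc p) ({1..p} - {m})" using m by (auto simp: p_def)
      moreover have "Suc m + Suc d = Suc p" by (simp add: p_def)
      moreover have "\<i> * coeff (lead \<theta> (Suc p)) 1 =
          \<i> * sin (\<theta> (Suc p)) * (\<i> * coeff (lead \<theta> p) 1) + \<i> * cos (\<theta> (Suc p)) * coeff (trail \<theta> p) 1"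
        by (simp add: algebra_simps)
      ultimately show ?case using Suc unfolding p_def[symmetric]
        by (simp add: coeff_trail_0)
    qed
    obtain d where d: "n = Suc m + d" using False m by (metis le_eq_less_or_eq less_eq_Suc_le le_Suc_ex)
    have "\<i> * coeff (lead \<theta> n) 1 =
        cos (\<theta> m) * (\<Prod>j\<in>{1..n} - {m}. \<i> * sin (\<theta> j)) * (side_cot \<theta> n q + side_cot \<theta> n (m + 1))"
      and "coeff (trail \<theta> n) 1 = 0"
      using tail[of d] unfolding d[symmetric] by auto
    moreover have "m - 1 = q" using q by simp
    ultimately show ?thesis by (simp only: charpoly_def coeff_diff diff_zero)
  qed
qed

text \<open>
  The symmetry of the transfer matrices makes the recursion for \<open>1 / \<epsilon>\<close> the recursion for \<open>\<epsilon>\<close> with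
  \<open>lead\<close> and \<open>trail\<close> exchanged, up to sign and powers of \<open>\<epsilon>\<close>. This duality reduces the limit of infinite
  contrast to that of vanishing contrast.
\<close>

lemma poly_chain_inverse:
  assumes "e \<noteq> 0"
  shows "e ^ Suc n * poly (lead \<theta> n) (inverse e) = - poly (trail \<theta> n) e \<and>
         e ^ Suc n * poly (trail \<theta> n) (inverse e) = - poly (lead \<theta> n) e"
proof (induction n)
  case (Suc n)
  define a where "a = e ^ Suc n * poly (lead \<theta> n) (inverse e)"
  define b where "b = e ^ Suc n * poly (trail \<theta> n) (inverse e)"
  have ab: "a = - poly (trail \<theta> n) e" "b = - poly (lead \<theta> n) e"
    using Suc by (auto simp: a_def b_def)
  have "e ^ Suc (Suc n) * poly (lead \<theta> (Suc n)) (inverse e) =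
      e * (\<i> * sin (\<theta> (Suc n)) * a + cos (\<theta> (Suc n)) * b)"
    by (simp add: a_def b_def algebra_simps)
  moreover have "e ^ Suc (Suc n) * poly (trail \<theta> (Suc n)) (inverse e) =
      cos (\<theta> (Suc n)) * a + \<i> * sin (\<theta> (Suc n)) * b"
    using assms by (simp add: a_def b_def field_simps)
  ultimately show ?case unfolding ab by (simp add: algebra_simps)
qed (use assms in simp)

lemma charpoly_inverse_zero_iff:
  assumes "e \<noteq> 0"
  shows "poly (charpoly \<theta> n) (inverse e) = 0 \<longleftrightarrow> poly (charpoly \<theta> n) e = 0"
proof -
  have "e ^ Suc n * poly (charpoly \<theta> n) (inverse e) = poly (charpoly \<theta> n) e"
    using poly_chain_inverse[OF assms, of n \<theta>] unfolding charpoly_def poly_diff right_diff_distrib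
    by simp
  then show ?thesis using assms by (metis mult_eq_0_iff power_not_zero)
qed

lemma degree_chain: "degree (lead \<theta> n) \<le> Suc n \<and> degree (trail \<theta> n) \<le> Suc n"
proof (induction n)
  case (Suc n)
  have "degree (smult a (lead \<theta> n) + smult b (trail \<theta> n)) \<le> Suc n" for a b
    using Suc by (intro degree_add_le) (meson degree_smult_le order_trans)+
  then show ?case
    by (auto intro: le_SucI order_trans[OF degree_pCons_le])
qed simp

lemma degree_charpoly: "degree (charpoly \<theta> n) \<le> Suc n"
  unfolding charpoly_def using degree_chain by (intro degree_diff_le) auto

lemma coeff_chain_holomorphic:
  "(\<lambda>z. coeff (lead (\<lambda>i. of_real (t i) * z) n) j) holomorphic_on A \<and>
   (\<lambda>z. coeff (trail (\<lambda>i. of_real (t i) * z) n) j) holomorphic_on A"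
proof (induction n arbitrary: j)
  case (Suc n)
  have l: "(\<lambda>z. coeff (lead (\<lambda>i. of_real (t i) * z) n) j) holomorphic_on A" for j using Suc by blast
  have tr: "(\<lambda>z. coeff (trail (\<lambda>i. of_real (t i) * z) n) j) holomorphic_on A" for j using Suc by blast
  show ?case
    by (cases j) (auto intro!: holomorphic_intros l tr)
qed (auto simp: coeff_pCons split: nat.split)

lemma coeff_charpoly_holomorphic:
  "(\<lambda>z. coeff (charpoly (\<lambda>i. of_real (t i) * z) n) j) holomorphic_on A"
  using coeff_chain_holomorphic by (auto simp: charpoly_def intro!: holomorphic_intros)

section \<open>Analytic root branches\<close>

lemma holomorphic_bounded_Lipschitz:
  assumes "h holomorphic_on ball z0 R" "0 < \<rho>" "\<rho> < R"
  shows "\<exists>B L. (\<forall>z\<in>cball z0 \<rho>. norm (h z) \<le> B) \<and>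
           (\<forall>z\<in>cball z0 \<rho>. \<forall>z'\<in>cball z0 \<rho>. norm (h z - h z') \<le> L * norm (z - z'))"
proof -
  have sub: "cball z0 \<rho> \<subseteq> ball z0 R" using assms by auto
  have "continuous_on (cball z0 \<rho>) h"
    using assms(1) sub holomorphic_on_imp_continuous_on continuous_on_subset by blast
  then obtain B where B: "\<forall>z\<in>cball z0 \<rho>. norm (h z) \<le> B"
    using compact_imp_bounded[OF compact_continuous_image[OF _ compact_cball]]
    by (force simp: bounded_iff)
  have "deriv h holomorphic_on ball z0 R" using assms(1) by (intro holomorphic_deriv) auto
  then have "continuous_on (cball z0 \<rho>) (deriv h)"
    using sub holomorphic_on_imp_continuous_on continuous_on_subset by blast
  then obtain L where L: "\<forall>z\<in>cball z0 \<rho>. norm (deriv h z) \<le> L"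
    using compact_imp_bounded[OF compact_continuous_image[OF _ compact_cball]]
    by (force simp: bounded_iff)
  have "norm (h z - h z') \<le> L * norm (z - z')" if "z \<in> cball z0 \<rho>" "z' \<in> cball z0 \<rho>" for z z'
  proof (rule field_differentiable_bound[of "cball z0 \<rho>" h "deriv h"])
    fix w assume "w \<in> cball z0 \<rho>"
    then have "w \<in> ball z0 R" using sub by blast
    then show "(h has_field_derivative deriv h w) (at w within cball z0 \<rho>)"
      using assms(1) holomorphic_derivI[of h "ball z0 R" w] by (auto intro: has_field_derivative_at_within)
  qed (use L that in auto)
  then show ?thesis using B by blast
qed

text \<open>
  For small \<open>e\<close> the map \<open>z \<mapsto> z0 - e * M z e\<close> is a contraction of a closed disc, with constant \<open>1/2\<close>
  uniformly in \<open>e\<close>. Its iterates starting from \<open>z0\<close> are holomorphic in \<open>e\<close> and converge uniformly to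
  the fixed point, which is therefore holomorphic in \<open>e\<close>. Inserting the fixed point once into the map
  gives the expansion up to second order. This serves as an implicit function theorem for equations
  that are polynomial in the parameter.
\<close>

lemma analytic_fixed_point:
  fixes h :: "nat \<Rightarrow> complex \<Rightarrow> complex"
  assumes hol: "\<And>j. j < d \<Longrightarrow> h j holomorphic_on ball z0 R" and "0 < R"
  defines "M \<equiv> \<lambda>z e. \<Sum>j<d. h j z * e ^ j"
  obtains \<rho> \<epsilon> \<zeta> K where "0 < \<rho>" "\<rho> \<le> R" "0 < \<epsilon>" "\<zeta> holomorphic_on ball 0 \<epsilon>"
    "\<And>e z. e \<in> ball 0 \<epsilon> \<Longrightarrow> z \<in> ball z0 \<rho> \<Longrightarrow> z = z0 - e * M z e \<longleftrightarrow> z = \<zeta> e"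
    "\<And>e. e \<in> ball 0 \<epsilon> \<Longrightarrow> \<zeta> e \<in> ball z0 \<rho>"
    "\<And>e. e \<in> ball 0 \<epsilon> \<Longrightarrow> norm (\<zeta> e - (z0 - e * M z0 0)) \<le> K * norm e ^ 2"
proof -
  define \<rho> where "\<rho> = R / 2"
  have \<rho>: "0 < \<rho>" "\<rho> < R" using \<open>0 < R\<close> by (auto simp: \<rho>_def)
  have cball_sub: "cball z0 \<rho> \<subseteq> ball z0 R" using \<rho> by auto
  have "\<forall>j. \<exists>B L. j < d \<longrightarrow> (\<forall>z\<in>cball z0 \<rho>. norm (h j z) \<le> B) \<and>
           (\<forall>z\<in>cball z0 \<rho>. \<forall>z'\<in>cball z0 \<rho>. norm (h j z - h j z') \<le> L * norm (z - z'))"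
    using holomorphic_bounded_Lipschitz[OF hol \<rho>] by blast
  then obtain b l where
    b: "\<And>j z. j < d \<Longrightarrow> z \<in> cball z0 \<rho> \<Longrightarrow> norm (h j z) \<le> b j" and
    l: "\<And>j z z'. j < d \<Longrightarrow> z \<in> cball z0 \<rho> \<Longrightarrow> z' \<in> cball z0 \<rho> \<Longrightarrow> norm (h j z - h j z') \<le> l j * norm (z - z')"
    by metis
  define B where "B = (\<Sum>j<d. \<bar>b j\<bar>)"
  define L where "L = (\<Sum>j<d. \<bar>l j\<bar>)"
  have BL: "0 \<le> B" "0 \<le> L" by (auto simp: B_def L_def intro: sum_nonneg)
  have M_bound: "norm (M z e) \<le> B" if "z \<in> cball z0 \<rho>" "norm e \<le> 1" for z e
    unfolding M_def B_def
  proof (rule sum_norm_le)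
    fix j assume "j \<in> {..<d}"
    then have "norm (h j z) \<le> \<bar>b j\<bar>" using b[of j z] that by auto
    then show "norm (h j z * e ^ j) \<le> \<bar>b j\<bar>"
      using mult_mono[of "norm (h j z)" "\<bar>b j\<bar>" "norm e ^ j" 1] that
      by (auto simp: norm_mult norm_power power_le_one)
  qed
  have M_Lip: "norm (M z e - M z' e) \<le> L * norm (z - z')"
    if "z \<in> cball z0 \<rho>" "z' \<in> cball z0 \<rho>" "norm e \<le> 1" for z z' e
    unfolding M_def L_def sum_distrib_right sum_subtractf[symmetric]
  proof (rule sum_norm_le)
    fix j assume "j \<in> {..<d}"
    then have "norm (h j z - h j z') \<le> l j * norm (z - z')" using l that by auto
    also have "\<dots> \<le> \<bar>l j\<bar> * norm (z - z')" by (intro mult_right_mono) auto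
    finally show "norm (h j z * e ^ j - h j z' * e ^ j) \<le> \<bar>l j\<bar> * norm (z - z')"
      using mult_mono[of "norm (h j z - h j z')" "\<bar>l j\<bar> * norm (z - z')" "norm e ^ j" 1] that
      by (auto simp: norm_mult norm_power power_le_one simp flip: left_diff_distrib)
  qed
  have M_at_0: "norm (M z e - M z 0) \<le> B * norm e" if "z \<in> cball z0 \<rho>" "norm e \<le> 1" for z e
    unfolding M_def B_def sum_distrib_right sum_subtractf[symmetric]
  proof (rule sum_norm_le)
    fix j assume j: "j \<in> {..<d}"
    show "norm (h j z * e ^ j - h j z * 0 ^ j) \<le> \<bar>b j\<bar> * norm e"
    proof (cases j)
      case (Suc i)
      have "norm (h j z) \<le> \<bar>b j\<bar>" using b[of j z] that j by auto
      moreover have "norm e ^ j \<le> norm e" using Suc that by (simp add: mult_left_le power_le_one)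
      ultimately show ?thesis using Suc
        by (simp add: norm_mult norm_power mult_mono del: power_Suc)
    qed simp
  qed
  \<comment> \<open>The second bound keeps the iterates within half the radius of the disc, the third makes the
     contraction constant \<open>1/2\<close>.\<close>
  define \<epsilon> where "\<epsilon> = min 1 (min (\<rho> / (2 * (B + 1))) (1 / (2 * (L + 1))))"
  have \<epsilon>: "0 < \<epsilon>" using BL \<rho> by (auto simp: \<epsilon>_def)
  have e1: "norm e \<le> 1" and eB: "norm e * B \<le> \<rho> / 2" and eL: "norm e * L \<le> 1 / 2"
    if "e \<in> ball 0 \<epsilon>" for e
  proof -
    have e: "norm e \<le> 1" "norm e \<le> \<rho> / (2 * (B + 1))" "norm e \<le> 1 / (2 * (L + 1))"
      using that by (auto simp: \<epsilon>_def)
    show "norm e \<le> 1" by fact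
    have "norm e * B \<le> norm e * (B + 1)" by (intro mult_left_mono) auto
    also have "\<dots> \<le> \<rho> / (2 * (B + 1)) * (B + 1)" using e BL by (intro mult_right_mono) auto
    also have "\<dots> = \<rho> / 2" using BL by (simp add: field_simps)
    finally show "norm e * B \<le> \<rho> / 2" .
    have "norm e * L \<le> norm e * (L + 1)" by (intro mult_left_mono) auto
    also have "\<dots> \<le> 1 / (2 * (L + 1)) * (L + 1)" using e BL by (intro mult_right_mono) auto
    also have "\<dots> = 1 / 2" using BL by (simp add: field_simps)
    finally show "norm e * L \<le> 1 / 2" .
  qed
  define T where "T e z = z0 - e * M z e" for e z
  have T_near: "norm (T e z - z0) \<le> \<rho> / 2" if "e \<in> ball 0 \<epsilon>" "z \<in> cball z0 \<rho>" for e z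
  proof -
    have "norm (T e z - z0) = norm e * norm (M z e)" by (simp add: T_def norm_mult)
    also have "\<dots> \<le> norm e * B" using M_bound that e1 by (intro mult_left_mono) auto
    finally show ?thesis using eB that by force
  qed
  have T_in: "T e z \<in> cball z0 \<rho>" if "e \<in> ball 0 \<epsilon>" "z \<in> cball z0 \<rho>" for e z
    using T_near[OF that] \<rho> by (simp add: dist_norm norm_minus_commute)
  have T_contr: "dist (T e z) (T e z') \<le> 1 / 2 * dist z z'"
    if "e \<in> ball 0 \<epsilon>" "z \<in> cball z0 \<rho>" "z' \<in> cball z0 \<rho>" for e z z'
  proof -
    have "dist (T e z) (T e z') = norm (e * (M z e - M z' e))"
      by (simp add: T_def dist_norm right_diff_distrib norm_minus_commute)
    also have "\<dots> \<le> norm e * (L * norm (z - z'))"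
      using M_Lip that e1 by (auto simp: norm_mult intro!: mult_left_mono)
    also have "\<dots> = norm e * L * dist z z'" by (simp add: dist_norm)
    also have "\<dots> \<le> 1 / 2 * dist z z'" using eL that by (intro mult_right_mono) auto
    finally show ?thesis .
  qed
  have "\<exists>!z\<in>cball z0 \<rho>. T e z = z" if "e \<in> ball 0 \<epsilon>" for e
    using \<rho> T_in T_contr that by (intro Banach_fix[where c = "1/2"]) (auto simp: complete_eq_closed)
  then obtain \<zeta> where \<zeta>_in: "\<And>e. e \<in> ball 0 \<epsilon> \<Longrightarrow> \<zeta> e \<in> cball z0 \<rho>"
    and \<zeta>_fix: "\<And>e. e \<in> ball 0 \<epsilon> \<Longrightarrow> T e (\<zeta> e) = \<zeta> e"
    and \<zeta>_uniq: "\<And>e z. e \<in> ball 0 \<epsilon> \<Longrightarrow> z \<in> cball z0 \<rho> \<Longrightarrow> T e z = z \<Longrightarrow> z = \<zeta> e"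
    by metis
  have \<zeta>_near: "norm (\<zeta> e - z0) \<le> \<rho> / 2" if "e \<in> ball 0 \<epsilon>" for e
    using T_near[OF that \<zeta>_in[OF that]] \<zeta>_fix[OF that] by simp
  define X where "X n e = (T e ^^ n) z0" for n e
  have X_in: "X n e \<in> cball z0 \<rho>" if "e \<in> ball 0 \<epsilon>" for n e
    using \<rho> T_in[OF that] by (induction n) (auto simp: X_def)
  have X_hol: "X n holomorphic_on ball 0 \<epsilon>" for n
  proof (induction n)
    case (Suc n)
    have "(h j \<circ> X n) holomorphic_on ball 0 \<epsilon>" if "j < d" for j
      using X_in cball_sub by (intro holomorphic_on_compose_gen[OF Suc hol[OF that]]) blast
    then have "(\<lambda>e. z0 - e * M (X n e) e) holomorphic_on ball 0 \<epsilon>"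
      unfolding M_def by (auto simp: o_def intro!: holomorphic_intros)
    then show ?case by (simp add: X_def T_def cong: holomorphic_cong)
  qed (simp add: X_def)
  have X_conv: "dist (X n e) (\<zeta> e) \<le> (1/2) ^ n * \<rho>" if "e \<in> ball 0 \<epsilon>" for n e
  proof (induction n)
    case 0
    then show ?case using \<zeta>_in[OF that] by (simp add: X_def)
  next
    case (Suc n)
    have "dist (X (Suc n) e) (\<zeta> e) = dist (T e (X n e)) (T e (\<zeta> e))"
      using \<zeta>_fix[OF that] by (simp add: X_def)
    also have "\<dots> \<le> 1 / 2 * dist (X n e) (\<zeta> e)"
      by (rule T_contr[OF that X_in[OF that] \<zeta>_in[OF that]])
    finally show ?case using Suc by simp
  qed
  have ul: "uniform_limit (ball 0 \<epsilon>) X \<zeta> sequentially"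
  proof (rule uniform_limitI)
    fix \<eta> :: real assume "\<eta> > 0"
    have "(\<lambda>n. (1/2) ^ n * \<rho>) \<longlonglongrightarrow> 0"
      by (intro tendsto_mult_left_zero LIMSEQ_power_zero) simp
    then have "\<forall>\<^sub>F n in sequentially. (1/2) ^ n * \<rho> < \<eta>"
      using \<open>\<eta> > 0\<close> by (rule order_tendstoD)
    then show "\<forall>\<^sub>F n in sequentially. \<forall>e\<in>ball 0 \<epsilon>. dist (X n e) (\<zeta> e) < \<eta>"
    proof eventually_elim
      case (elim n)
      then show ?case using X_conv by (meson le_less_trans)
    qed
  qed
  have "\<zeta> holomorphic_on ball 0 \<epsilon>"
  proof (rule holomorphic_uniform_sequence[OF open_ball X_hol])
    fix x :: complex assume "x \<in> ball 0 \<epsilon>"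
    then obtain r where "0 < r" "cball x r \<subseteq> ball 0 \<epsilon>"
      using open_contains_cball open_ball by blast
    then show "\<exists>r>0. cball x r \<subseteq> ball 0 \<epsilon> \<and> uniform_limit (cball x r) X \<zeta> sequentially"
      using uniform_limit_on_subset[OF ul] by blast
  qed
  moreover have "z = z0 - e * M z e \<longleftrightarrow> z = \<zeta> e" if "e \<in> ball 0 \<epsilon>" "z \<in> ball z0 \<rho>" for e z
    using \<zeta>_uniq[OF that(1), of z] \<zeta>_fix[OF that(1)] that(2) unfolding T_def by force
  moreover have "\<zeta> e \<in> ball z0 \<rho>" if "e \<in> ball 0 \<epsilon>" for e
    using \<zeta>_near[OF that] \<rho> by (simp add: dist_norm norm_minus_commute)
  moreover have "norm (\<zeta> e - (z0 - e * M z0 0)) \<le> (L * B + B) * norm e ^ 2" if e: "e \<in> ball 0 \<epsilon>" for e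
  proof -
    have z0: "z0 \<in> cball z0 \<rho>" using \<rho> by simp
    have fixed: "\<zeta> e = z0 - e * M (\<zeta> e) e" using \<zeta>_fix[OF e] by (simp add: T_def)
    have "norm (\<zeta> e - z0) = norm e * norm (M (\<zeta> e) e)"
      by (subst fixed) (simp add: norm_mult)
    also have "\<dots> \<le> norm e * B" using M_bound \<zeta>_in e1 e by (intro mult_left_mono) auto
    finally have "L * norm (\<zeta> e - z0) \<le> L * (norm e * B)" using BL(2) by (rule mult_left_mono)
    then have "norm (M (\<zeta> e) e - M z0 e) \<le> L * (norm e * B)"
      using M_Lip[OF \<zeta>_in[OF e] z0 e1[OF e]] by linarith
    moreover have "norm (M z0 e - M z0 0) \<le> B * norm e" by (rule M_at_0[OF z0 e1[OF e]])
    ultimately have "norm (M (\<zeta> e) e - M z0 0) \<le> (L * B + B) * norm e"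
      using norm_triangle_ineq[of "M (\<zeta> e) e - M z0 e" "M z0 e - M z0 0"] by (simp add: algebra_simps)
    then have "norm e * norm (M (\<zeta> e) e - M z0 0) \<le> norm e * ((L * B + B) * norm e)"
      by (intro mult_left_mono) auto
    moreover
    have "\<zeta> e - (z0 - e * M z0 0) = - (e * (M (\<zeta> e) e - M z0 0))"
      by (subst fixed) (simp add: algebra_simps)
    then have "norm (\<zeta> e - (z0 - e * M z0 0)) = norm e * norm (M (\<zeta> e) e - M z0 0)"
      by (simp only: norm_minus_cancel norm_mult)
    ultimately show ?thesis by (simp add: power2_eq_square mult_ac)
  qed
  ultimately show ?thesis using that[of \<rho> \<epsilon> \<zeta> "L * B + B"] \<rho> \<epsilon> by simp
qed

text \<open>
  At \<open>e = 0\<close> the characteristic polynomial is the product of the \<open>\<i> * sin (t j * z)\<close>, which has a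
  simple zero at \<open>k0\<close> because exactly one factor vanishes there. Dividing by the cofactor \<open>g\<close> of
  \<open>z - k0\<close> turns the equation into a fixed point problem \<open>z = k0 - e * M z e\<close>. The slope \<open>- M k0 0\<close>
  of the branch is minus the quotient of the coefficient of \<open>e\<close> by \<open>g k0\<close>, in which all factors except
  those of interval \<open>m\<close> and its neighbours cancel.
\<close>

lemma charpoly_root_branch:
  fixes t :: "nat \<Rightarrow> real" and k0 :: real and n :: nat
  defines "\<theta> \<equiv> \<lambda>z i. of_real (t i) * z"
  assumes m: "1 \<le> m" "m \<le> n" "t m \<noteq> 0" and zero: "sin (t m * k0) = 0"
    and nz: "\<And>j. 1 \<le> j \<Longrightarrow> j \<le> n \<Longrightarrow> j \<noteq> m \<Longrightarrow> sin (t j * k0) \<noteq> 0"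
    and "0 < R"
  obtains \<rho> \<epsilon> \<zeta> K where "0 < \<rho>" "\<rho> \<le> R" "0 < \<epsilon>" "\<zeta> holomorphic_on ball 0 \<epsilon>"
    "\<And>e z. e \<in> ball 0 \<epsilon> \<Longrightarrow> z \<in> ball (of_real k0) \<rho> \<Longrightarrow> poly (charpoly (\<theta> z) n) e = 0 \<longleftrightarrow> z = \<zeta> e"
    "\<And>e. e \<in> ball 0 \<epsilon> \<Longrightarrow> \<zeta> e \<in> ball (of_real k0) \<rho>"
    "\<And>e. e \<in> ball 0 \<epsilon> \<Longrightarrow>
       norm (\<zeta> e - (of_real k0 + (side_cot (\<theta> (of_real k0)) n (m - 1) + side_cot (\<theta> (of_real k0)) n (m + 1))
          / of_real (t m) * e)) \<le> K * norm e ^ 2"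
proof -
  define z0 :: complex where "z0 = of_real k0"
  define P where "P = (\<Prod>j\<in>{1..n} - {m}. \<i> * sin (\<theta> z0 j))"
  define S where "S = side_cot (\<theta> z0) n (m - 1) + side_cot (\<theta> z0) n (m + 1)"
  define c where "c j z = coeff (charpoly (\<theta> z) n) j" for j z
  have sin_real: "sin (\<theta> z0 j) = of_real (sin (t j * k0))" for j
    by (simp add: \<theta>_def z0_def flip: sin_of_real of_real_mult)
  have cos_nz: "cos (\<theta> z0 m) \<noteq> 0"
    using sin_cos_squared_add[of "\<theta> z0 m"] zero sin_real[of m] by auto
  have P_nz: "P \<noteq> 0" using nz by (auto simp: P_def sin_real)
  have c_hol: "c j holomorphic_on A" for j A
    unfolding c_def \<theta>_def by (rule coeff_charpoly_holomorphic)
  have c0: "c 0 z = (\<Prod>j\<in>{1..n} - {m}. \<i> * sin (\<theta> z j)) * (\<i> * sin (\<theta> z m))" for z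
    unfolding c_def coeff_charpoly_0 using m by (subst prod.remove[of _ m]) auto
  have c0_z0: "c 0 z0 = 0" using zero sin_real[of m] by (simp add: c0)
  have "((\<lambda>z. \<i> * sin (\<theta> z m)) has_field_derivative \<i> * (of_real (t m) * cos (\<theta> z0 m))) (at z0)"
    unfolding \<theta>_def by (auto intro!: derivative_eq_intros)
  note d1 = this
  have "(\<lambda>z. \<Prod>j\<in>{1..n} - {m}. \<i> * sin (\<theta> z j)) field_differentiable at z0"
    by (rule holomorphic_on_imp_differentiable_at[of _ UNIV])
      (auto simp: \<theta>_def intro!: holomorphic_intros)
  then obtain D where "((\<lambda>z. \<Prod>j\<in>{1..n} - {m}. \<i> * sin (\<theta> z j)) has_field_derivative D) (at z0)"
    by (auto simp: field_differentiable_def)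
  from DERIV_mult[OF this d1]
  have "(c 0 has_field_derivative P * (\<i> * (of_real (t m) * cos (\<theta> z0 m)))) (at z0)"
    using zero sin_real[of m] unfolding c0[abs_def] P_def by (simp add: mult.commute)
  then have c0': "deriv (c 0) z0 = P * (\<i> * (of_real (t m) * cos (\<theta> z0 m)))"
    by (rule DERIV_imp_deriv)
  define g where "g z = (if z = z0 then deriv (c 0) z0 else (c 0 z - c 0 z0) / (z - z0))" for z
  have g_hol: "g holomorphic_on UNIV"
    unfolding g_def[abs_def] by (rule pole_lemma_open[OF c_hol]) simp
  have c0_g: "c 0 z = (z - z0) * g z" for z by (simp add: g_def c0_z0)
  have g_z0: "g z0 \<noteq> 0" using m P_nz cos_nz by (simp add: g_def c0')
  have "isCont g z0"
    using g_hol holomorphic_on_imp_continuous_on[of g UNIV] by (simp add: continuous_on_eq_continuous_at)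
  then have "\<forall>\<^sub>F z in at z0. g z \<noteq> 0"
    using g_z0 tendsto_imp_eventually_ne unfolding isCont_def by blast
  then have "\<forall>\<^sub>F z in nhds z0. g z \<noteq> 0"
    using g_z0 by (simp add: eventually_nhds_conv_at)
  then obtain r where r: "0 < r" "\<And>z. z \<in> ball z0 r \<Longrightarrow> g z \<noteq> 0"
    by (auto simp: eventually_nhds_metric dist_commute)
  define R' where "R' = min r R"
  have R': "0 < R'" "R' \<le> R" "\<And>z. z \<in> ball z0 R' \<Longrightarrow> g z \<noteq> 0" using r \<open>0 < R\<close> by (auto simp: R'_def)
  define h where "h j z = c (Suc j) z / g z" for j z
  have h_hol: "h j holomorphic_on ball z0 R'" for j
    unfolding h_def[abs_def] using R'(3) holomorphic_on_subset[OF g_hol]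
    by (intro holomorphic_on_divide c_hol) auto
  define M where "M z e = (\<Sum>j<Suc n. h j z * e ^ j)" for z e
  have poly_eq: "poly (charpoly (\<theta> z) n) e = g z * (z - (z0 - e * M z e))" if "z \<in> ball z0 R'" for z e
  proof -
    have "poly (charpoly (\<theta> z) n) e = (\<Sum>j\<le>Suc n. c j z * e ^ j)"
      unfolding c_def
      by (subst poly_as_sum_of_monoms'[OF degree_charpoly, symmetric]) (simp add: poly_sum poly_monom)
    also have "\<dots> = c 0 z + (\<Sum>j<Suc n. c (Suc j) z * e ^ Suc j)"
      by (simp only: sum.lessThan_Suc_shift flip: lessThan_Suc_atMost) simp
    also have "\<dots> = (z - z0) * g z + g z * (e * M z e)"
      using R'(3)[OF that] by (simp add: c0_g M_def h_def sum_distrib_left mult_ac del: sum.lessThan_Suc)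
    finally show ?thesis by (simp add: algebra_simps)
  qed
  have M0: "M z0 0 = - S / of_real (t m)"
  proof -
    have "\<i> * c 1 z0 = cos (\<theta> z0 m) * P * S"
      unfolding c_def P_def S_def using m zero nz by (intro coeff_charpoly_1_at_zero) (auto simp: sin_real)
    moreover have "c 1 z0 = - (\<i> * (\<i> * c 1 z0))" by simp
    ultimately have "c 1 z0 = - (\<i> * (cos (\<theta> z0 m) * P * S))" by simp
    then have "h 0 z0 = - S / of_real (t m)"
      using P_nz cos_nz m by (simp add: h_def g_def c0' field_simps)
    moreover have "M z0 0 = h 0 z0"
      unfolding M_def by (subst sum.lessThan_Suc_shift) simp
    ultimately show ?thesis by simp
  qed
  obtain \<rho> \<epsilon> \<zeta> K where *: "0 < \<rho>" "\<rho> \<le> R'" "0 < \<epsilon>" "\<zeta> holomorphic_on ball 0 \<epsilon>"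
    "\<And>e z. e \<in> ball 0 \<epsilon> \<Longrightarrow> z \<in> ball z0 \<rho> \<Longrightarrow> z = z0 - e * M z e \<longleftrightarrow> z = \<zeta> e"
    "\<And>e. e \<in> ball 0 \<epsilon> \<Longrightarrow> \<zeta> e \<in> ball z0 \<rho>"
    "\<And>e. e \<in> ball 0 \<epsilon> \<Longrightarrow> norm (\<zeta> e - (z0 - e * M z0 0)) \<le> K * norm e ^ 2"
    using analytic_fixed_point[of "Suc n" h z0 R', OF h_hol R'(1)] unfolding M_def by blast
  show thesis
  proof (rule that[OF *(1) _ *(3,4)])
    show "\<rho> \<le> R" using * R' by simp
    show "poly (charpoly (\<theta> z) n) e = 0 \<longleftrightarrow> z = \<zeta> e" if "e \<in> ball 0 \<epsilon>" "z \<in> ball (of_real k0) \<rho>" for e z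
    proof -
      have z: "z \<in> ball z0 \<rho>" "z \<in> ball z0 R'" using that *(2) by (auto simp: z0_def)
      show ?thesis unfolding *(5)[OF that(1) z(1), symmetric] poly_eq[OF z(2)]
        using R'(3)[OF z(2)] by simp
    qed
    show "\<zeta> e \<in> ball (of_real k0) \<rho>" if "e \<in> ball 0 \<epsilon>" for e using *(6)[OF that] by (simp add: z0_def)
    show "norm (\<zeta> e - (of_real k0 + (side_cot (\<theta> (of_real k0)) n (m - 1) + side_cot (\<theta> (of_real k0)) n (m + 1))
          / of_real (t m) * e)) \<le> K * norm e ^ 2" if "e \<in> ball 0 \<epsilon>" for e
    proof -
      have "z0 - e * M z0 0 = z0 + S / of_real (t m) * e" unfolding M0 by simp
      from *(7)[OF that, unfolded this] show ?thesis unfolding S_def z0_def .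
    qed
  qed
qed

section \<open>Sequences of amplitudes\<close>

text \<open>
  The values \<open>U i\<close> of \<open>u\<close> at the end points and the right-hand limits \<open>V i\<close> of \<open>u' / (\<i> * \<kappa>)\<close> there
  determine a solution. These are the relations between them: radiation on both sides, transfer
  across each interval, and the flux conditions. In contrast to a recursion, they keep their meaning
  for \<open>e = 0\<close>, where the flux condition on leaving a resonator does not determine the next \<open>V\<close>.
\<close>

definition amplitudes ::
  "nat \<Rightarrow> complex \<Rightarrow> (nat \<Rightarrow> complex) \<Rightarrow> (nat \<Rightarrow> complex) \<Rightarrow> (nat \<Rightarrow> complex) \<Rightarrow> bool"
where
  "amplitudes N e \<phi> U V \<longleftrightarrow>
     V 1 = - e * U 1 \<and> V (2 * N) = U (2 * N) \<and>
     (\<forall>i\<in>{1..<2 * N}.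
        U (Suc i) = cos (\<phi> i) * U i + \<i> * sin (\<phi> i) * V i \<and>
        (if odd i then e * V (Suc i) = \<i> * sin (\<phi> i) * U i + cos (\<phi> i) * V i
         else V (Suc i) = e * (\<i> * sin (\<phi> i) * U i + cos (\<phi> i) * V i)))"

text \<open>
  The exponent counts the flux conditions met on leaving a resonator; each of them leaves one factor
  \<open>e\<close> on the unknown side, which the polynomial recursion does not divide by.
\<close>

lemma amplitudes_eq_chain:
  assumes amp: "amplitudes N e \<phi> U V" and "n < 2 * N"
  shows "e ^ (Suc n div 2) * (if even n then U (Suc n) else V (Suc n)) = U 1 * poly (lead \<phi> n) e \<and>
         e ^ (Suc n div 2) * (if even n then V (Suc n) else U (Suc n)) = U 1 * poly (trail \<phi> n) e"
  using \<open>n < 2 * N\<close>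
proof (induction n)
  case 0
  then show ?case using amp by (simp add: amplitudes_def)
next
  case (Suc n)
  define p where "p = e ^ (Suc n div 2)"
  define c where "c = cos (\<phi> (Suc n))"
  define s where "s = \<i> * sin (\<phi> (Suc n))"
  have step: "U (Suc (Suc n)) = c * U (Suc n) + s * V (Suc n)"
    "if even n then e * V (Suc (Suc n)) = s * U (Suc n) + c * V (Suc n)
     else V (Suc (Suc n)) = e * (s * U (Suc n) + c * V (Suc n))"
    using amp Suc.prems by (simp_all add: amplitudes_def c_def s_def)
  have chain: "poly (lead \<phi> (Suc n)) e = s * poly (lead \<phi> n) e + c * poly (trail \<phi> n) e"
    "poly (trail \<phi> (Suc n)) e = e * (c * poly (lead \<phi> n) e + s * poly (trail \<phi> n) e)"
    by (simp_all add: c_def s_def)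
  show ?case
  proof (cases "even n")
    case True
    have IH: "p * U (Suc n) = U 1 * poly (lead \<phi> n) e" "p * V (Suc n) = U 1 * poly (trail \<phi> n) e"
      using Suc True by (simp_all add: p_def)
    have "Suc (Suc n) div 2 = Suc (Suc n div 2)" using True by (auto elim!: evenE)
    then have p': "e ^ (Suc (Suc n) div 2) = p * e" by (simp add: p_def)
    have "p * e * V (Suc (Suc n)) = p * (s * U (Suc n) + c * V (Suc n))"
      using step(2) True by (metis mult.assoc)
    then have "p * e * V (Suc (Suc n)) = s * (p * U (Suc n)) + c * (p * V (Suc n))"
      by (simp add: algebra_simps)
    moreover have "p * e * U (Suc (Suc n)) = e * (c * (p * U (Suc n)) + s * (p * V (Suc n)))"
      unfolding step(1) by (simp add: algebra_simps)
    ultimately show ?thesis using True unfolding p' IH chain by (simp add: algebra_simps)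
  next
    case False
    have IH: "p * V (Suc n) = U 1 * poly (lead \<phi> n) e" "p * U (Suc n) = U 1 * poly (trail \<phi> n) e"
      using Suc False by (simp_all add: p_def)
    have "Suc (Suc n) div 2 = Suc n div 2" using False by (auto elim!: oddE)
    then have p': "e ^ (Suc (Suc n) div 2) = p" by (simp add: p_def)
    have "p * U (Suc (Suc n)) = c * (p * U (Suc n)) + s * (p * V (Suc n))"
      unfolding step(1) by (simp add: algebra_simps)
    moreover have "p * V (Suc (Suc n)) = e * (s * (p * U (Suc n)) + c * (p * V (Suc n)))"
      using step(2) False by (simp add: algebra_simps)
    ultimately show ?thesis using False unfolding p' IH chain by (simp add: algebra_simps)
  qed
qed

definition nontrivial :: "nat \<Rightarrow> (nat \<Rightarrow> complex) \<Rightarrow> (nat \<Rightarrow> complex) \<Rightarrow> bool" where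
  "nontrivial N U V \<longleftrightarrow> (\<exists>i\<in>{1..2 * N}. U i \<noteq> 0 \<or> V i \<noteq> 0)"

lemma poly_charpoly_0: "poly (charpoly \<phi> n) 0 = (\<Prod>j=1..n. \<i> * sin (\<phi> j))"
  by (simp add: poly_0_coeff_0 coeff_charpoly_0)

text \<open>
  For \<open>e \<noteq> 0\<close> all amplitudes are multiples of \<open>U 1\<close>, so the radiation condition on the right forces
  the polynomial to vanish. For \<open>e = 0\<close> the intervals decouple: resonators have Neumann conditions
  (\<open>V = 0\<close>) at both ends, and once these are empty the gaps have Dirichlet conditions, so that a
  nontrivial sequence requires one of the sines to vanish.
\<close>

lemma amplitudes_imp_charpoly_zero:
  assumes amp: "amplitudes N e \<phi> U V" and nontriv: "nontrivial N U V" and "1 \<le> N"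
  shows "poly (charpoly \<phi> (2 * N - 1)) e = 0"
proof (cases "e = 0")
  case False
  note chain = amplitudes_eq_chain[OF amp]
  have "U 1 \<noteq> 0"
  proof
    assume "U 1 = 0"
    then have "U (Suc n) = 0 \<and> V (Suc n) = 0" if "n < 2 * N" for n
      using chain[OF that] False by (simp split: if_splits)
    then have "U i = 0 \<and> V i = 0" if "i \<in> {1..2 * N}" for i
      using that by (cases i) auto
    then show False using nontriv by (auto simp: nontrivial_def)
  qed
  have "Suc (2 * N - 1) = 2 * N" "odd (2 * N - 1)" using \<open>1 \<le> N\<close> by auto
  then have "U 1 * poly (lead \<phi> (2 * N - 1)) e = e ^ N * U (2 * N)"
    and "U 1 * poly (trail \<phi> (2 * N - 1)) e = e ^ N * U (2 * N)"
    using chain[of "2 * N - 1"] amp \<open>1 \<le> N\<close> by (auto simp: amplitudes_def)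
  then show ?thesis using \<open>U 1 \<noteq> 0\<close> by (metis charpoly_def poly_diff mult_left_cancel diff_self)
next
  case True
  have rel: "U (Suc i) = cos (\<phi> i) * U i + \<i> * sin (\<phi> i) * V i"
    "odd i \<Longrightarrow> \<i> * sin (\<phi> i) * U i + cos (\<phi> i) * V i = 0"
    "even i \<Longrightarrow> V (Suc i) = 0" if "1 \<le> i" "i < 2 * N" for i
  proof -
    have "U (Suc i) = cos (\<phi> i) * U i + \<i> * sin (\<phi> i) * V i \<and>
        (if odd i then e * V (Suc i) = \<i> * sin (\<phi> i) * U i + cos (\<phi> i) * V i
         else V (Suc i) = e * (\<i> * sin (\<phi> i) * U i + cos (\<phi> i) * V i))"
      using amp that by (simp add: amplitudes_def)
    then show "U (Suc i) = cos (\<phi> i) * U i + \<i> * sin (\<phi> i) * V i"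
      "odd i \<Longrightarrow> \<i> * sin (\<phi> i) * U i + cos (\<phi> i) * V i = 0"
      "even i \<Longrightarrow> V (Suc i) = 0"
      using True by auto
  qed
  show ?thesis
  proof (rule ccontr)
    assume "poly (charpoly \<phi> (2 * N - 1)) e \<noteq> 0"
    then have s: "sin (\<phi> i) \<noteq> 0" if "1 \<le> i" "i < 2 * N" for i
      using that True by (auto simp: poly_charpoly_0)
    have odd0: "U i = 0 \<and> V i = 0" if "odd i" "i < 2 * N" for i
    proof -
      have "V i = 0"
      proof (cases "i = 1")
        case True
        then show ?thesis using amp \<open>e = 0\<close> by (simp add: amplitudes_def)
      next
        case False
        obtain j where j: "i = Suc j" using \<open>odd i\<close> by (cases i) auto
        have "1 \<le> j" "even j" "j < 2 * N" using that False j by auto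
        then show ?thesis using rel(3)[of j] j by simp
      qed
      moreover have "1 \<le> i" using that by (cases i) auto
      ultimately show ?thesis using rel(2)[of i] s[of i] that by simp
    qed
    have even_U: "U i = 0" if "even i" "1 \<le> i" "i \<le> 2 * N" for i
    proof -
      obtain j where j: "i = Suc j" using \<open>1 \<le> i\<close> by (cases i) auto
      have "odd j" using that j by simp
      then have "1 \<le> j" by (cases j) auto
      then show ?thesis using rel(1)[of j] odd0[OF \<open>odd j\<close>] j that by simp
    qed
    have even_V: "V i = 0" if "even i" "1 \<le> i" "i \<le> 2 * N" for i
    proof (cases "i = 2 * N")
      case True
      then show ?thesis using amp even_U[OF that] by (simp add: amplitudes_def)
    next
      case False
      then have "i < 2 * N" "Suc i < 2 * N" using that by (auto elim!: evenE)
      then have "\<i> * sin (\<phi> i) * V i = 0"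
        using rel(1)[of i] odd0[of "Suc i"] even_U[OF that] that by simp
      then show ?thesis using s[of i] that \<open>i < 2 * N\<close> by simp
    qed
    have "U i = 0 \<and> V i = 0" if "i \<in> {1..2 * N}" for i
      using that odd0[of i] even_U[of i] even_V[of i] by (cases "even i") (auto simp: le_less)
    then show False using nontriv by (auto simp: nontrivial_def)
  qed
qed

text \<open>
  For \<open>e = 0\<close> a vanishing sine belongs to a Dirichlet mode of a gap, which can be extended by zero,
  or to a Neumann mode of a resonator. The latter needs nonzero solutions in the two neighbouring
  intervals that match its boundary values; they exist when no gap has a Dirichlet mode, and so gap
  modes are considered first.
\<close>

lemma charpoly_zero_imp_amplitudes:
  assumes "poly (charpoly \<phi> (2 * N - 1)) e = 0" "1 \<le> N"
  shows "\<exists>U V. amplitudes N e \<phi> U V \<and> nontrivial N U V"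
proof (cases "e = 0")
  case False
  define M where "M i = poly (lead \<phi> (i - 1)) e / e ^ (i div 2)" for i
  define T where "T i = poly (trail \<phi> (i - 1)) e / e ^ (i div 2)" for i
  define U where "U i = (if odd i then M i else T i)" for i
  define V where "V i = (if odd i then T i else M i)" for i
  have "amplitudes N e \<phi> U V"
    unfolding amplitudes_def
  proof (intro conjI ballI)
    show "V 1 = - e * U 1" by (simp add: U_def V_def M_def T_def)
    show "V (2 * N) = U (2 * N)"
      using assms by (simp add: U_def V_def M_def T_def charpoly_def)
    fix i assume "i \<in> {1..<2 * N}"
    then obtain n where n: "i = Suc n" by (cases i) auto
    show "U (Suc i) = cos (\<phi> i) * U i + \<i> * sin (\<phi> i) * V i"
      "if odd i then e * V (Suc i) = \<i> * sin (\<phi> i) * U i + cos (\<phi> i) * V i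
       else V (Suc i) = e * (\<i> * sin (\<phi> i) * U i + cos (\<phi> i) * V i)"
      using False
      by (cases "even n"; auto simp: n U_def V_def M_def T_def field_simps elim!: evenE oddE)+
  qed
  moreover have "U 1 \<noteq> 0" by (simp add: U_def M_def)
  ultimately show ?thesis using \<open>1 \<le> N\<close> unfolding nontrivial_def
    by (intro exI[of _ U] exI[of _ V]) auto
next
  case True
  have "\<exists>j\<in>{1..2 * N - 1}. sin (\<phi> j) = 0"
    using assms True by (simp add: poly_charpoly_0)
  then obtain j0 where j0: "1 \<le> j0" "j0 < 2 * N" "sin (\<phi> j0) = 0" using \<open>1 \<le> N\<close> by auto
  show ?thesis
  proof (cases "\<exists>j. even j \<and> 1 \<le> j \<and> j < 2 * N \<and> sin (\<phi> j) = 0")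
    case True
    then obtain j where j: "even j" "1 \<le> j" "j < 2 * N" "sin (\<phi> j) = 0" by blast
    have "amplitudes N e \<phi> (\<lambda>i. 0) (\<lambda>i. if i = j then 1 else 0)"
      using j \<open>e = 0\<close> by (auto simp: amplitudes_def)
    then show ?thesis using j unfolding nontrivial_def by (intro exI conjI) auto
  next
    case False
    define j where "j = j0"
    have j: "odd j" "1 \<le> j" "j < 2 * N" "sin (\<phi> j) = 0" using j0 False by (auto simp: j_def)
    define c where "c = cos (\<phi> j)"
    \<comment> \<open>The gaps next to resonator \<open>j\<close> interpolate between its boundary values and \<open>0\<close>; in the exterior the value is radiated away.\<close>
    define U where "U i = (if i = j then 1 else if i = Suc j then c else 0)" for i
    define V where "V i =
      (if i = Suc j then (if i = 2 * N then c else - cos (\<phi> i) * c / (\<i> * sin (\<phi> i)))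
       else if Suc i = j then 1 / (\<i> * sin (\<phi> i)) else 0)" for i
    have "amplitudes N e \<phi> U V"
      unfolding amplitudes_def
    proof (intro conjI ballI)
      show "V 1 = - e * U 1" using j \<open>e = 0\<close> by (auto simp: V_def)
      show "V (2 * N) = U (2 * N)" using j by (auto simp: U_def V_def)
      fix i assume i: "i \<in> {1..<2 * N}"
      then have s: "even i \<Longrightarrow> sin (\<phi> i) \<noteq> 0" using False by auto
      show "U (Suc i) = cos (\<phi> i) * U i + \<i> * sin (\<phi> i) * V i"
      proof (cases "odd i")
        case True
        then show ?thesis using j by (auto simp: U_def V_def c_def)
      next
        case False
        then show ?thesis using j s i by (auto simp: U_def V_def c_def)
      qed
      show "if odd i then e * V (Suc i) = \<i> * sin (\<phi> i) * U i + cos (\<phi> i) * V i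
       else V (Suc i) = e * (\<i> * sin (\<phi> i) * U i + cos (\<phi> i) * V i)"
        using j \<open>e = 0\<close> by (auto simp: U_def V_def)
    qed
    moreover have "U j \<noteq> 0" by (simp add: U_def)
    ultimately show ?thesis using j unfolding nontrivial_def
      by (intro exI[of _ U] exI[of _ V]) auto
  qed
qed

section \<open>Waves on an interval\<close>

definition wave :: "complex \<Rightarrow> real \<Rightarrow> complex \<Rightarrow> complex \<Rightarrow> real \<Rightarrow> complex" where
  "wave \<kappa> p U V x = U * cos (\<kappa> * of_real (x - p)) + \<i> * V * sin (\<kappa> * of_real (x - p))"

definition wave_deriv :: "complex \<Rightarrow> real \<Rightarrow> complex \<Rightarrow> complex \<Rightarrow> real \<Rightarrow> complex" where
  "wave_deriv \<kappa> p U V x =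
     \<i> * \<kappa> * (\<i> * U * sin (\<kappa> * of_real (x - p)) + V * cos (\<kappa> * of_real (x - p)))"

lemma sin_cos_affine_has_vector_derivative:
  fixes \<kappa> :: complex
  shows "((\<lambda>x. cos (\<kappa> * of_real (x - p))) has_vector_derivative - \<kappa> * sin (\<kappa> * of_real (x - p))) (at x within S)"
    and "((\<lambda>x. sin (\<kappa> * of_real (x - p))) has_vector_derivative \<kappa> * cos (\<kappa> * of_real (x - p))) (at x within S)"
proof -
  have "((\<lambda>z. cos (\<kappa> * (z - of_real p))) has_field_derivative - \<kappa> * sin (\<kappa> * (of_real x - of_real p))) (at (of_real x))"
       "((\<lambda>z. sin (\<kappa> * (z - of_real p))) has_field_derivative \<kappa> * cos (\<kappa> * (of_real x - of_real p))) (at (of_real x))"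
    by (auto intro!: derivative_eq_intros)
  from this[THEN has_vector_derivative_real_field]
  show "((\<lambda>x. cos (\<kappa> * of_real (x - p))) has_vector_derivative - \<kappa> * sin (\<kappa> * of_real (x - p))) (at x within S)"
    and "((\<lambda>x. sin (\<kappa> * of_real (x - p))) has_vector_derivative \<kappa> * cos (\<kappa> * of_real (x - p))) (at x within S)"
    by simp_all
qed

lemma wave_has_vector_derivative:
  "(wave \<kappa> p U V has_vector_derivative wave_deriv \<kappa> p U V x) (at x within S)"
  "(wave_deriv \<kappa> p U V has_vector_derivative - (\<kappa>\<^sup>2 * wave \<kappa> p U V x)) (at x within S)"
proof -
  note d = has_vector_derivative_add[OF has_vector_derivative_mult_right has_vector_derivative_mult_right]
  show "(wave \<kappa> p U V has_vector_derivative wave_deriv \<kappa> p U V x) (at x within S)"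
    unfolding wave_def[abs_def] wave_deriv_def
    by (rule has_vector_derivative_eq_rhs, rule d, (rule sin_cos_affine_has_vector_derivative)+)
      (simp add: algebra_simps)
  show "(wave_deriv \<kappa> p U V has_vector_derivative - (\<kappa>\<^sup>2 * wave \<kappa> p U V x)) (at x within S)"
    unfolding wave_def wave_deriv_def[abs_def]
    by (rule has_vector_derivative_eq_rhs, rule has_vector_derivative_mult_right, rule d,
        (rule sin_cos_affine_has_vector_derivative)+)
      (simp add: algebra_simps power2_eq_square)
qed

lemma wave_isCont: "isCont (wave \<kappa> p U V) x" "isCont (wave_deriv \<kappa> p U V) x"
  using wave_has_vector_derivative[where S = UNIV] has_vector_derivative_continuous by blast+

lemma wave_at_base: "wave \<kappa> p U V p = U" "wave_deriv \<kappa> p U V p = \<i> * \<kappa> * V"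
  by (simp_all add: wave_def wave_deriv_def)

lemma wave_deriv_travelling:
  "wave_deriv \<kappa> p U U x = \<i> * \<kappa> * wave \<kappa> p U U x"
  "wave_deriv \<kappa> p U (- U) x = - (\<i> * \<kappa> * wave \<kappa> p U (- U) x)"
  by (simp_all add: wave_def wave_deriv_def algebra_simps)

text \<open>
  Variation of constants: the coefficients \<open>\<alpha>\<close> and \<open>\<beta>\<close> of \<open>u\<close> with respect to cosine and sine, obtained
  by rotating \<open>(u, u' / \<kappa>)\<close> back, have derivative zero. Hence they equal their limits at \<open>p\<close>, which
  may be an end point of \<open>S\<close>.
\<close>

lemma Helmholtz_solution_is_wave:
  fixes u u' :: "real \<Rightarrow> complex"
  assumes S: "convex S" "at p within S \<noteq> bot" and "\<kappa> \<noteq> 0"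
    and u: "\<And>x. x \<in> S \<Longrightarrow> (u has_vector_derivative u' x) (at x)"
    and u': "\<And>x. x \<in> S \<Longrightarrow> (u' has_vector_derivative - (\<kappa>\<^sup>2 * u x)) (at x)"
    and lim: "(u \<longlongrightarrow> U) (at p within S)" "(u' \<longlongrightarrow> \<i> * \<kappa> * V) (at p within S)"
    and "x \<in> S"
  shows "u x = wave \<kappa> p U V x" "u' x = wave_deriv \<kappa> p U V x"
proof -
  define c s where "c x = cos (\<kappa> * of_real (x - p))" and "s x = sin (\<kappa> * of_real (x - p))" for x
  have dc: "(c has_vector_derivative - \<kappa> * s x) (at x within A)"
    and ds: "(s has_vector_derivative \<kappa> * c x) (at x within A)" for x A
    unfolding c_def[abs_def] s_def[abs_def] by (rule sin_cos_affine_has_vector_derivative)+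
  define \<alpha> where "\<alpha> x = u x * c x - inverse \<kappa> * u' x * s x" for x
  define \<beta> where "\<beta> x = u x * s x + inverse \<kappa> * u' x * c x" for x
  have d\<alpha>: "(\<alpha> has_vector_derivative 0) (at x within S)"
    and d\<beta>: "(\<beta> has_vector_derivative 0) (at x within S)" if "x \<in> S" for x
  proof -
    note du = has_vector_derivative_at_within[OF u[OF that]]
    note du' = has_vector_derivative_mult_right[OF has_vector_derivative_at_within[OF u'[OF that]]]
    show "(\<alpha> has_vector_derivative 0) (at x within S)"
      unfolding \<alpha>_def[abs_def]
      by (rule has_vector_derivative_eq_rhs,
          rule has_vector_derivative_diff[OF has_vector_derivative_mult[OF du dc]
            has_vector_derivative_mult[OF du' ds]])
        (use \<open>\<kappa> \<noteq> 0\<close> in \<open>simp add: field_simps power2_eq_square\<close>)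
    show "(\<beta> has_vector_derivative 0) (at x within S)"
      unfolding \<beta>_def[abs_def]
      by (rule has_vector_derivative_eq_rhs,
          rule has_vector_derivative_add[OF has_vector_derivative_mult[OF du ds]
            has_vector_derivative_mult[OF du' dc]])
        (use \<open>\<kappa> \<noteq> 0\<close> in \<open>simp add: field_simps power2_eq_square\<close>)
  qed
  have lc: "(c \<longlongrightarrow> 1) (at p within S)" and ls: "(s \<longlongrightarrow> 0) (at p within S)"
    using has_vector_derivative_continuous[OF dc[of p S]] has_vector_derivative_continuous[OF ds[of p S]]
    by (simp_all add: continuous_within c_def s_def)
  have const: "f x = l" if df: "\<And>x. x \<in> S \<Longrightarrow> (f has_vector_derivative 0) (at x within S)"
    and fl: "(f \<longlongrightarrow> l) (at p within S)" for f :: "real \<Rightarrow> complex" and l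
  proof -
    obtain d where d: "\<And>y. y \<in> S \<Longrightarrow> f y = d"
      using has_vector_derivative_zero_constant[OF S(1) df] by blast
    have "(f \<longlongrightarrow> d) (at p within S)"
      by (rule tendsto_eventually) (auto simp: eventually_at_filter d)
    then show ?thesis using tendsto_unique[OF S(2) fl] d \<open>x \<in> S\<close> by simp
  qed
  have "(\<alpha> \<longlongrightarrow> U * 1 - inverse \<kappa> * (\<i> * \<kappa> * V) * 0) (at p within S)"
    unfolding \<alpha>_def[abs_def] by (intro tendsto_intros lim lc ls)
  then have \<alpha>: "\<alpha> x = U" using const[OF d\<alpha>] by simp
  have "(\<beta> \<longlongrightarrow> U * 0 + inverse \<kappa> * (\<i> * \<kappa> * V) * 1) (at p within S)"
    unfolding \<beta>_def[abs_def] by (intro tendsto_intros lim lc ls)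
  then have \<beta>: "\<beta> x = \<i> * V" using const[OF d\<beta>] \<open>\<kappa> \<noteq> 0\<close> by simp
  have cs: "c x * c x + s x * s x = 1"
    using sin_cos_squared_add[of "\<kappa> * of_real (x - p)"] by (simp add: c_def s_def power2_eq_square add.commute)
  have "u x = u x * (c x * c x + s x * s x)" by (simp add: cs)
  also have "\<dots> = \<alpha> x * c x + \<beta> x * s x" by (simp add: \<alpha>_def \<beta>_def algebra_simps)
  finally show "u x = wave \<kappa> p U V x" unfolding \<alpha> \<beta> by (simp add: wave_def c_def s_def)
  have "u' x = \<kappa> * (inverse \<kappa> * u' x * (c x * c x + s x * s x))" using \<open>\<kappa> \<noteq> 0\<close> by (simp add: cs)
  also have "\<dots> = \<kappa> * (\<beta> x * c x - \<alpha> x * s x)" by (simp add: \<alpha>_def \<beta>_def algebra_simps)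
  finally show "u' x = wave_deriv \<kappa> p U V x" unfolding \<alpha> \<beta>
    by (simp add: wave_deriv_def c_def s_def algebra_simps)
qed

section \<open>Nodes and cells of a chain of resonators\<close>

locale resonator_chain =
  fixes N :: nat and xm xp :: "nat \<Rightarrow> real"
  assumes N_pos: "1 \<le> N"
    and resonator: "\<And>j. 1 \<le> j \<Longrightarrow> j \<le> N \<Longrightarrow> xm j < xp j"
    and spacing: "\<And>j. 1 \<le> j \<Longrightarrow> j < N \<Longrightarrow> xp j < xm (j + 1)"
begin

text \<open>
  The end points in increasing order are the nodes \<open>1, \<dots>, 2 * N\<close>. Cell \<open>i\<close> is the open interval
  to the right of node \<open>i\<close>; thus odd cells are resonators and even cells are gaps, except that the
  cells \<open>0\<close> and \<open>2 * N\<close> are the unbounded parts of the background.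
\<close>

definition node :: "nat \<Rightarrow> real" where
  "node i = (if odd i then xm ((i + 1) div 2) else xp (i div 2))"

definition cell :: "nat \<Rightarrow> real set" where
  "cell i = {x. (1 \<le> i \<longrightarrow> node i < x) \<and> (i < 2 * N \<longrightarrow> x < node (Suc i))}"

lemma node_less_Suc:
  assumes "1 \<le> i" "i < 2 * N"
  shows "node i < node (Suc i)"
proof (cases "even i")
  case True
  then obtain j where "i = 2 * j" by blast
  then show ?thesis using assms spacing[of j] by (simp add: node_def)
next
  case False
  then obtain j where "i = 2 * j + 1" using oddE by blast
  then show ?thesis using assms resonator[of "Suc j"] by (simp add: node_def)
qed

lemma node_strict_mono: "1 \<le> i \<Longrightarrow> i < j \<Longrightarrow> j \<le> 2 * N \<Longrightarrow> node i < node j"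
proof (induction j)
  case (Suc j)
  then show ?case using node_less_Suc[of j] by (cases "i = j") auto
qed simp

lemma node_mono: "1 \<le> i \<Longrightarrow> i \<le> j \<Longrightarrow> j \<le> 2 * N \<Longrightarrow> node i \<le> node j"
  using node_strict_mono[of i j] by (cases "i = j") auto

definition cell_index :: "real \<Rightarrow> nat" where
  "cell_index x = Max {i. i \<le> 2 * N \<and> (i = 0 \<or> node i \<le> x)}"

lemma cell_index_eqI:
  assumes "i \<le> 2 * N" "1 \<le> i \<Longrightarrow> node i \<le> x" "i < 2 * N \<Longrightarrow> x < node (Suc i)"
  shows "cell_index x = i"
  unfolding cell_index_def
proof (rule Max_eqI)
  show "j \<le> i" if "j \<in> {i. i \<le> 2 * N \<and> (i = 0 \<or> node i \<le> x)}" for j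
  proof (rule ccontr)
    assume "\<not> j \<le> i"
    then have "node (Suc i) \<le> node j" "i < 2 * N" using that by (auto intro!: node_mono)
    then show False using that assms(3) \<open>\<not> j \<le> i\<close> by auto
  qed
  show "i \<in> {i. i \<le> 2 * N \<and> (i = 0 \<or> node i \<le> x)}" using assms by (cases "i = 0") auto
qed auto

lemma cell_index_bounds:
  "cell_index x \<le> 2 * N"
  "1 \<le> cell_index x \<Longrightarrow> node (cell_index x) \<le> x"
  "cell_index x < 2 * N \<Longrightarrow> x < node (Suc (cell_index x))"
proof -
  let ?I = "{i. i \<le> 2 * N \<and> (i = 0 \<or> node i \<le> x)}"
  have "cell_index x \<in> ?I" unfolding cell_index_def by (rule Max_in) auto
  then show "cell_index x \<le> 2 * N" "1 \<le> cell_index x \<Longrightarrow> node (cell_index x) \<le> x" by auto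
  show "x < node (Suc (cell_index x))" if "cell_index x < 2 * N"
  proof (rule ccontr)
    assume "\<not> ?thesis"
    then have "Suc (cell_index x) \<in> ?I" using that by simp
    then have "Suc (cell_index x) \<le> cell_index x" unfolding cell_index_def by (intro Max_ge) auto
    then show False by simp
  qed
qed

lemma cell_index_cell: "i \<le> 2 * N \<Longrightarrow> x \<in> cell i \<Longrightarrow> cell_index x = i"
  by (rule cell_index_eqI) (auto simp: cell_def)

lemma cell_index_node: "1 \<le> i \<Longrightarrow> i \<le> 2 * N \<Longrightarrow> cell_index (node i) = i"
  by (rule cell_index_eqI) (auto intro: node_less_Suc)

lemma in_cell_or_node:
  "x \<in> cell (cell_index x) \<or> (1 \<le> cell_index x \<and> x = node (cell_index x))"
  using cell_index_bounds[of x] by (force simp: cell_def)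

lemma open_cell: "open (cell i)"
  unfolding cell_def by (intro open_Collect_conj open_Collect_imp open_Collect_less continuous_intros) auto

lemma convex_cell: "convex (cell i)"
  unfolding convex_contains_segment cell_def
  by (auto simp: closed_segment_eq_real_ivl split: if_splits)

lemma resonators_eq: "resonators N xm xp = (\<Union>i\<in>{i. i \<le> 2 * N \<and> odd i}. cell i)"
proof -
  have c: "cell (2 * j - 1) = {xm j<..<xp j}" if "j \<in> {1..N}" for j
    using that by (auto simp: cell_def node_def)
  have "{i. i \<le> 2 * N \<and> odd i} = (\<lambda>j. 2 * j - 1) ` {1..N}"
  proof (intro equalityI subsetI)
    fix i assume "i \<in> {i. i \<le> 2 * N \<and> odd i}"
    then show "i \<in> (\<lambda>j. 2 * j - 1) ` {1..N}"
      by (intro image_eqI[of _ _ "Suc i div 2"]) (auto elim!: oddE)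
  qed auto
  then show ?thesis unfolding resonators_def using c by auto
qed

lemma closure_resonators: "closure (resonators N xm xp) = (\<Union>j\<in>{1..N}. {xm j..xp j})"
proof -
  have "closure (resonators N xm xp) = (\<Union>j\<in>{1..N}. closure {xm j<..<xp j})"
    unfolding resonators_def by (induction N) (simp_all add: atLeastAtMostSuc_conv)
  also have "\<dots> = (\<Union>j\<in>{1..N}. {xm j..xp j})"
    using resonator by (intro SUP_cong) auto
  finally show ?thesis .
qed

lemma background_eq: "- closure (resonators N xm xp) = (\<Union>i\<in>{i. i \<le> 2 * N \<and> even i}. cell i)"
proof (intro equalityI subsetI)
  fix x assume "x \<in> (\<Union>i\<in>{i. i \<le> 2 * N \<and> even i}. cell i)"
  then obtain i where "2 * i \<le> 2 * N" and x: "x \<in> cell (2 * i)" by auto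
  have "\<not> (xm j \<le> x \<and> x \<le> xp j)" if "1 \<le> j" "j \<le> N" for j
  proof (cases "j \<le> i")
    case True
    then have "node (2 * j) \<le> node (2 * i)" using that \<open>2 * i \<le> 2 * N\<close> by (intro node_mono) auto
    then show ?thesis using x True that by (auto simp: cell_def node_def)
  next
    case False
    then have "node (2 * i + 1) \<le> node (2 * j - 1)" using that by (intro node_mono) auto
    moreover have "node (2 * j - 1) = xm j" using that by (auto simp: node_def)
    ultimately show ?thesis using x False that by (auto simp: cell_def)
  qed
  then show "x \<in> - closure (resonators N xm xp)" by (auto simp: closure_resonators)
next
  fix x assume x: "x \<in> - closure (resonators N xm xp)"
  define i where "i = cell_index x"
  have out: "\<not> (xm j \<le> x \<and> x \<le> xp j)" if "1 \<le> j" "j \<le> N" for j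
    using x that by (auto simp: closure_resonators)
  have "even i"
  proof (rule ccontr)
    assume "odd i"
    then obtain j where j: "i = 2 * j + 1" using oddE by blast
    moreover have "2 * j + 1 < 2 * N"
      using cell_index_bounds(1)[of x] unfolding i_def[symmetric] j by presburger
    ultimately show False using cell_index_bounds[of x] out[of "Suc j"] by (simp add: i_def[symmetric] node_def)
  qed
  moreover have "\<not> (1 \<le> i \<and> x = node i)"
    using \<open>even i\<close> out[of "i div 2"] cell_index_bounds(1)[of x] resonator[of "i div 2"]
    by (auto simp: node_def i_def[symmetric] elim!: evenE)
  ultimately show "x \<in> (\<Union>i\<in>{i. i \<le> 2 * N \<and> even i}. cell i)"
    using in_cell_or_node[of x] cell_index_bounds(1)[of x] by (auto simp: i_def[symmetric])
qed

lemma ball_resonators_iff_ball_nodes: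
  "(\<forall>j\<in>{1..N}. P (2 * j - 1) \<and> P (2 * j)) \<longleftrightarrow> (\<forall>i\<in>{1..2 * N}. P i)"
proof
  assume *: "\<forall>j\<in>{1..N}. P (2 * j - 1) \<and> P (2 * j)"
  show "\<forall>i\<in>{1..2 * N}. P i"
  proof
    fix i assume "i \<in> {1..2 * N}"
    then show "P i" using *[rule_format, of "Suc i div 2"] by (cases "even i") (auto elim!: evenE oddE)
  qed
next
  assume *: "\<forall>i\<in>{1..2 * N}. P i"
  have "2 * j - 1 \<in> {1..2 * N} \<and> 2 * j \<in> {1..2 * N}" if "j \<in> {1..N}" for j using that by auto
  then show "\<forall>j\<in>{1..N}. P (2 * j - 1) \<and> P (2 * j)" using * by blast
qed

end

section \<open>Resonances as zeros of the characteristic polynomial\<close>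

definition wavenumber :: "real \<Rightarrow> complex \<Rightarrow> nat \<Rightarrow> complex" where
  "wavenumber r k i = of_real (if odd i then r else 1) * k"

text \<open>
  The filters of the one-sided limits at a node are traces of its punctured neighbourhoods on the
  two adjacent cells, so a one-sided limit can be read off from a continuous function that agrees
  with the given one on a single cell.
\<close>

lemma tendsto_within_if_agrees_with_continuous:
  assumes "isCont h p" "\<And>x. x \<in> S \<Longrightarrow> g x = h x"
  shows "(g \<longlongrightarrow> h p) (at p within S)"
proof (rule Lim_transform_eventually)
  show "(h \<longlongrightarrow> h p) (at p within S)"
    using assms(1) unfolding isCont_def by (rule tendsto_within_subset) simp
  show "\<forall>\<^sub>F x in at p within S. h x = g x"
    using assms(2) by (auto simp: eventually_at_filter)
qed

lemma at_left_end_within_interval: "a < b \<Longrightarrow> at a within {a<..<b} = at_right (a::real)"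
  by (rule at_within_nhd[of a "{..<b}"]) auto

lemma at_right_end_within_interval: "a < b \<Longrightarrow> at b within {a<..<b} = at_left (b::real)"
  by (rule at_within_nhd[of b "{a<..}"]) auto

context resonator_chain
begin

text \<open>
  Resonators and background, and likewise left and right end points, enter the scattering problem in
  the same way up to the parity of an index; numbering nodes and cells consecutively makes this
  visible.
\<close>

definition cellwise_solution ::
  "real \<Rightarrow> complex \<Rightarrow> complex \<Rightarrow> (real \<Rightarrow> complex) \<Rightarrow> (real \<Rightarrow> complex) \<Rightarrow> bool"
where
  "cellwise_solution r \<delta> k u u' \<longleftrightarrow>
     (\<forall>i\<le>2 * N. \<forall>x\<in>cell i. (u has_vector_derivative u' x) (at x) \<and>
        (u' has_vector_derivative - ((wavenumber r k i)\<^sup>2 * u x)) (at x)) \<and>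
     (\<forall>i\<in>{1..2 * N}. has_traces u (node i) (u (node i)) (u (node i)) \<and>
        (\<exists>a. has_traces u' (node i) (if odd i then a else \<delta> * a) (if odd i then \<delta> * a else a))) \<and>
     (\<forall>x\<in>cell 0. u' x = - (\<i> * k * u x)) \<and>
     (\<forall>x\<in>cell (2 * N). u' x = \<i> * k * u x)"

lemma SP_solution_iff_cellwise:
  assumes "v > 0" "vb > 0"
  shows "SP_solution N xm xp v vb \<delta> (of_real v * k) u \<longleftrightarrow> (\<exists>u'. cellwise_solution (v / vb) \<delta> k u u')"
proof -
  let ?D = "resonators N xm xp"
  have k: "of_real v * k / of_real v = k" "of_real v * k / of_real vb = of_real (v / vb) * k"
    using assms by simp_all
  have ext: "{x. x < xm 1} = cell 0" "{x. x > xp N} = cell (2 * N)"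
    using N_pos by (auto simp: cell_def node_def)
  have eqs: "((\<forall>x\<in>?D \<union> - closure ?D. (u has_vector_derivative u' x) (at x)) \<and>
       (\<forall>x\<in>- closure ?D. (u' has_vector_derivative - (k\<^sup>2 * u x)) (at x)) \<and>
       (\<forall>x\<in>?D. (u' has_vector_derivative - ((of_real (v / vb) * k)\<^sup>2 * u x)) (at x))) \<longleftrightarrow>
     (\<forall>i\<le>2 * N. \<forall>x\<in>cell i. (u has_vector_derivative u' x) (at x) \<and>
        (u' has_vector_derivative - ((wavenumber (v / vb) k i)\<^sup>2 * u x)) (at x))" for u'
    unfolding background_eq unfolding resonators_eq wavenumber_def by (auto split: if_splits)
  have nodes: "(\<forall>j\<in>{1..N}. has_traces u (xm j) (u (xm j)) (u (xm j)) \<and>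
          has_traces u (xp j) (u (xp j)) (u (xp j)) \<and>
          (\<exists>a. has_traces u' (xm j) a (\<delta> * a)) \<and>
          (\<exists>a. has_traces u' (xp j) (\<delta> * a) a)) \<longleftrightarrow>
     (\<forall>i\<in>{1..2 * N}. has_traces u (node i) (u (node i)) (u (node i)) \<and>
        (\<exists>a. has_traces u' (node i) (if odd i then a else \<delta> * a) (if odd i then \<delta> * a else a)))" for u'
    unfolding ball_resonators_iff_ball_nodes[symmetric]
    by (intro ball_cong) (auto simp: node_def)
  have minus_eq: "- a - b = 0 \<longleftrightarrow> a = - b" for a b :: complex
    by (metis add_eq_0_iff2 diff_conv_add_uminus neg_equal_0_iff_equal minus_add_distrib)
  have rad: "(\<forall>x<xm 1. - u' x - \<i> * k * u x = 0) \<longleftrightarrow> (\<forall>x\<in>cell 0. u' x = - (\<i> * k * u x))"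
    "(\<forall>x>xp N. u' x - \<i> * k * u x = 0) \<longleftrightarrow> (\<forall>x\<in>cell (2 * N). u' x = \<i> * k * u x)" for u'
    unfolding ext[symmetric] unfolding minus_eq unfolding right_minus_eq by auto
  show ?thesis
    unfolding SP_solution_def Let_def k cellwise_solution_def eqs[symmetric] nodes[symmetric] rad[symmetric]
    by (simp only: conj_assoc)
qed

lemma at_node_within_cell:
  assumes "1 \<le> i" "i \<le> 2 * N"
  shows "at (node i) within cell i = at_right (node i)"
proof (cases "i = 2 * N")
  case True
  then show ?thesis using assms by (auto simp: cell_def greaterThan_def)
next
  case False
  then have "cell i = {node i<..<node (Suc i)}" using assms by (auto simp: cell_def)
  moreover have "node i < node (Suc i)" using node_less_Suc[of i] assms False by simp
  ultimately show ?thesis by (simp add: at_left_end_within_interval)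
qed

lemma at_node_Suc_within_cell:
  assumes "i < 2 * N"
  shows "at (node (Suc i)) within cell i = at_left (node (Suc i))"
proof (cases "i = 0")
  case True
  then show ?thesis using assms by (auto simp: cell_def lessThan_def)
next
  case False
  then have "cell i = {node i<..<node (Suc i)}" using assms by (auto simp: cell_def)
  moreover have "node i < node (Suc i)" using node_less_Suc[of i] assms False by simp
  ultimately show ?thesis by (simp add: at_right_end_within_interval)
qed

lemma optical_length_phase:
  "of_real (tvec r xm xp i) * k = wavenumber r k i * of_real (node (Suc i) - node i)"
  by (auto simp: tvec_def wavenumber_def node_def len_def gap_def)

lemma wavenumber_nonzero: "r > 0 \<Longrightarrow> k \<noteq> 0 \<Longrightarrow> wavenumber r k i \<noteq> 0"
  by (simp add: wavenumber_def)

lemma wave_at_next_node: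
  "wave (wavenumber r k i) (node i) U V (node (Suc i)) =
     cos (of_real (tvec r xm xp i) * k) * U + \<i> * sin (of_real (tvec r xm xp i) * k) * V"
  "wave_deriv (wavenumber r k i) (node i) U V (node (Suc i)) =
     \<i> * wavenumber r k i *
       (\<i> * sin (of_real (tvec r xm xp i) * k) * U + cos (of_real (tvec r xm xp i) * k) * V)"
  unfolding optical_length_phase by (simp_all add: wave_def wave_deriv_def algebra_simps)

text \<open>
  On every cell the solution is a wave that is determined by its limits at the left node. Evaluating
  this wave at the right node and inserting the flux conditions gives the relations between
  amplitudes. A solution whose amplitudes all vanish is zero on every cell and at every node.
\<close>

lemma cellwise_solution_imp_amplitudes:
  assumes sol: "cellwise_solution r \<delta> k u u'" and "r > 0" "k \<noteq> 0" and "u \<noteq> (\<lambda>x. 0)"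
  shows "\<exists>U V. amplitudes N (\<delta> / of_real r) (\<lambda>i. of_real (tvec r xm xp i) * k) U V \<and> nontrivial N U V"
proof -
  let ?\<kappa> = "wavenumber r k"
  have \<kappa>_nz: "?\<kappa> i \<noteq> 0" for i using wavenumber_nonzero assms by blast
  have du: "(u has_vector_derivative u' x) (at x)"
    and du': "(u' has_vector_derivative - ((?\<kappa> i)\<^sup>2 * u x)) (at x)" if "i \<le> 2 * N" "x \<in> cell i" for i x
    using sol that by (auto simp: cellwise_solution_def)
  have ul: "(u \<longlongrightarrow> u (node i)) (at_left (node i))" and ur: "(u \<longlongrightarrow> u (node i)) (at_right (node i))"
    if "i \<in> {1..2 * N}" for i
    using sol that by (auto simp: cellwise_solution_def has_traces_def)
  have "\<exists>a. \<forall>i\<in>{1..2 * N}. has_traces u' (node i) (if odd i then a i else \<delta> * a i) (if odd i then \<delta> * a i else a i)"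
    using sol unfolding cellwise_solution_def by (intro bchoice) blast
  then obtain a where a: "\<And>i. i \<in> {1..2 * N} \<Longrightarrow>
      has_traces u' (node i) (if odd i then a i else \<delta> * a i) (if odd i then \<delta> * a i else a i)"
    by blast
  define U where "U i = u (node i)" for i
  \<comment> \<open>\<open>a i\<close> is the limit of \<open>u'\<close> at node \<open>i\<close> taken from the background, and \<open>b i\<close> its limit from the right.\<close>
  define b where "b i = (if odd i then \<delta> * a i else a i)" for i
  define V where "V i = b i / (\<i> * ?\<kappa> i)" for i
  have b_V: "b i = \<i> * ?\<kappa> i * V i" for i using \<kappa>_nz by (simp add: V_def)
  have u'r: "(u' \<longlongrightarrow> \<i> * ?\<kappa> i * V i) (at_right (node i))" if "i \<in> {1..2 * N}" for i
    using a[OF that] unfolding has_traces_def b_V[symmetric] b_def by simp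
  have u'l: "(u' \<longlongrightarrow> (if odd i then a i else \<delta> * a i)) (at_left (node i))" if "i \<in> {1..2 * N}" for i
    using a[OF that] unfolding has_traces_def by simp
  have in_cell: "u x = wave (?\<kappa> i) (node i) (U i) (V i) x" "u' x = wave_deriv (?\<kappa> i) (node i) (U i) (V i) x"
    if i: "i \<in> {1..2 * N}" and x: "x \<in> cell i" for i x
  proof -
    have f: "at (node i) within cell i = at_right (node i)" using i by (intro at_node_within_cell) auto
    note * = Helmholtz_solution_is_wave[of "cell i" "node i" "?\<kappa> i" u u' "U i" "V i" x,
        OF convex_cell _ \<kappa>_nz du du' _ _ x]
    show "u x = wave (?\<kappa> i) (node i) (U i) (V i) x" "u' x = wave_deriv (?\<kappa> i) (node i) (U i) (V i) x"
      by (rule *; use i ur[OF i] u'r[OF i] in \<open>simp add: f U_def\<close>)+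
  qed
  have left_end: "at (node 1) within cell 0 = at_left (node 1)"
    using N_pos at_node_Suc_within_cell[of 0] by simp
  have u_left: "(u \<longlongrightarrow> U 1) (at (node 1) within cell 0)"
    unfolding left_end U_def using N_pos by (intro ul) auto
  have u'_left: "(u' \<longlongrightarrow> - (\<i> * k * U 1)) (at (node 1) within cell 0)"
  proof (rule Lim_transform_eventually)
    show "((\<lambda>x. - (\<i> * k * u x)) \<longlongrightarrow> - (\<i> * k * U 1)) (at (node 1) within cell 0)"
      by (intro tendsto_intros u_left)
    show "\<forall>\<^sub>F x in at (node 1) within cell 0. - (\<i> * k * u x) = u' x"
      using sol by (auto simp: eventually_at_filter cellwise_solution_def)
  qed
  have left_cell: "u x = wave k (node 1) (U 1) (- U 1) x" if x: "x \<in> cell 0" for x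
  proof -
    have nb: "at (node 1) within cell 0 \<noteq> bot" unfolding left_end by simp
    have k: "?\<kappa> 0 = k" by (simp add: wavenumber_def)
    have "u x = wave (?\<kappa> 0) (node 1) (U 1) (- U 1) x"
      using u_left u'_left
      by (intro Helmholtz_solution_is_wave(1)[OF convex_cell nb \<kappa>_nz du du' _ _ x]) (simp_all add: k)
    then show ?thesis by (simp only: k)
  qed
  have "(u' \<longlongrightarrow> a 1) (at_left (node 1))" using u'l[of 1] N_pos by simp
  then have left_flux: "a 1 = - (\<i> * k * U 1)"
    using u'_left tendsto_unique[OF trivial_limit_at_left_real] unfolding left_end by blast
  have right_flux: "\<i> * ?\<kappa> (2 * N) * V (2 * N) = \<i> * k * U (2 * N)"
  proof (rule tendsto_unique)
    show "at_right (node (2 * N)) \<noteq> bot" by simp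
    show "(u' \<longlongrightarrow> \<i> * ?\<kappa> (2 * N) * V (2 * N)) (at_right (node (2 * N)))" using N_pos by (intro u'r) auto
    show "(u' \<longlongrightarrow> \<i> * k * U (2 * N)) (at_right (node (2 * N)))"
    proof (rule Lim_transform_eventually)
      show "((\<lambda>x. \<i> * k * u x) \<longlongrightarrow> \<i> * k * U (2 * N)) (at_right (node (2 * N)))"
        unfolding U_def using N_pos by (intro tendsto_intros ur) auto
      have f: "at (node (2 * N)) within cell (2 * N) = at_right (node (2 * N))"
        using N_pos by (intro at_node_within_cell) auto
      show "\<forall>\<^sub>F x in at_right (node (2 * N)). \<i> * k * u x = u' x"
        unfolding f[symmetric] using sol by (auto simp: eventually_at_filter cellwise_solution_def)
    qed
  qed
  have next_node: "U (Suc i) = wave (?\<kappa> i) (node i) (U i) (V i) (node (Suc i))"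
    "(if odd i then \<delta> * a (Suc i) else a (Suc i)) = wave_deriv (?\<kappa> i) (node i) (U i) (V i) (node (Suc i))"
    if i: "i \<in> {1..<2 * N}" for i
  proof -
    have f: "at (node (Suc i)) within cell i = at_left (node (Suc i))" using i by (intro at_node_Suc_within_cell) auto
    note lim = tendsto_within_if_agrees_with_continuous[where S = "cell i" and p = "node (Suc i)", unfolded f]
    have i': "i \<in> {1..2 * N}" "Suc i \<in> {1..2 * N}" using i by auto
    show "U (Suc i) = wave (?\<kappa> i) (node i) (U i) (V i) (node (Suc i))"
      unfolding U_def[of "Suc i"]
      by (rule tendsto_unique[OF trivial_limit_at_left_real ul[OF i'(2)] lim[OF wave_isCont(1) in_cell(1)[OF i'(1)]]])
    show "(if odd i then \<delta> * a (Suc i) else a (Suc i)) = wave_deriv (?\<kappa> i) (node i) (U i) (V i) (node (Suc i))"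
      using tendsto_unique[OF trivial_limit_at_left_real u'l[OF i'(2)] lim[OF wave_isCont(2) in_cell(2)[OF i'(1)]]]
      by (cases "even i") simp_all
  qed
  have "amplitudes N (\<delta> / of_real r) (\<lambda>i. of_real (tvec r xm xp i) * k) U V"
    unfolding amplitudes_def
  proof (intro conjI ballI)
    have "V 1 = \<delta> * a 1 / (\<i> * (of_real r * k))" by (simp add: V_def b_def wavenumber_def)
    then show "V 1 = - (\<delta> / of_real r) * U 1"
      unfolding left_flux using \<open>k \<noteq> 0\<close> \<open>r > 0\<close> by (simp add: field_simps)
    show "V (2 * N) = U (2 * N)" using right_flux \<open>k \<noteq> 0\<close> by (simp add: wavenumber_def)
    fix i assume i: "i \<in> {1..<2 * N}"
    show "U (Suc i) = cos (of_real (tvec r xm xp i) * k) * U i + \<i> * sin (of_real (tvec r xm xp i) * k) * V i"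
      using next_node(1)[OF i] by (simp add: wave_at_next_node)
    define W where "W = \<i> * sin (of_real (tvec r xm xp i) * k) * U i + cos (of_real (tvec r xm xp i) * k) * V i"
    have "(if odd i then \<delta> * a (Suc i) else a (Suc i)) = \<i> * ?\<kappa> i * W"
      using next_node(2)[OF i] unfolding wave_at_next_node(2) W_def .
    then show "if odd i then \<delta> / of_real r * V (Suc i) = W else V (Suc i) = \<delta> / of_real r * W"
      using \<open>r > 0\<close> \<open>k \<noteq> 0\<close> by (auto simp: V_def b_def wavenumber_def)
  qed
  moreover have "nontrivial N U V"
  proof (rule ccontr)
    assume "\<not> nontrivial N U V"
    then have z: "U i = 0" "V i = 0" if "i \<in> {1..2 * N}" for i using that by (auto simp: nontrivial_def)
    have "u x = 0" for x
    proof -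
      define i where "i = cell_index x"
      have i: "i \<le> 2 * N" using cell_index_bounds(1) by (simp add: i_def)
      consider "x \<in> cell 0" | "x \<in> cell i" "i \<in> {1..2 * N}" | "x = node i" "i \<in> {1..2 * N}"
        using in_cell_or_node[of x] i by (cases "i = 0") (auto simp: i_def[symmetric])
      then show ?thesis
      proof cases
        case 1
        then show ?thesis using left_cell[of x] z[of 1] N_pos by (simp add: wave_def)
      next
        case 2
        then show ?thesis using in_cell(1)[of i x] z[of i] by (simp add: wave_def)
      next
        case 3
        then show ?thesis using z[of i] by (simp add: U_def)
      qed
    qed
    then show False using \<open>u \<noteq> (\<lambda>x. 0)\<close> by auto
  qed
  ultimately show ?thesis by blast
qed

text \<open>
  The solution is glued from one wave per cell, extended to the left node of the cell. The wave to
  the left of all resonators has no left node and is based at its right node instead.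
\<close>

lemma amplitudes_imp_cellwise_solution:
  assumes amp: "amplitudes N (\<delta> / of_real r) (\<lambda>i. of_real (tvec r xm xp i) * k) U V"
    and nontriv: "nontrivial N U V" and "r > 0" "k \<noteq> 0"
  shows "\<exists>u u'. cellwise_solution r \<delta> k u u' \<and> u \<noteq> (\<lambda>x. 0)"
proof -
  let ?\<kappa> = "wavenumber r k"
  define piece where "piece i = wave (?\<kappa> i) (node (max 1 i)) (U (max 1 i)) (if i = 0 then - U 1 else V i)" for i
  define piece' where "piece' i = wave_deriv (?\<kappa> i) (node (max 1 i)) (U (max 1 i)) (if i = 0 then - U 1 else V i)" for i
  define u where "u x = piece (cell_index x) x" for x
  define u' where "u' x = piece' (cell_index x) x" for x
  have u_cell: "u x = piece i x" "u' x = piece' i x" if "i \<le> 2 * N" "x \<in> cell i" for i x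
    using that by (simp_all add: u_def u'_def cell_index_cell)
  have u_node: "u (node i) = U i" if "i \<in> {1..2 * N}" for i
    using that by (simp add: u_def cell_index_node piece_def wave_at_base max_def)
  have right: "piece i (node i) = U i" "piece' i (node i) = \<i> * ?\<kappa> i * V i" if "1 \<le> i" for i
    using that by (simp_all add: piece_def piece'_def wave_at_base max_def)
  define W where "W i = \<i> * sin (of_real (tvec r xm xp i) * k) * U i + cos (of_real (tvec r xm xp i) * k) * V i" for i
  have left: "piece i (node (Suc i)) = U (Suc i)" if "i < 2 * N" for i
  proof (cases "i = 0")
    case False
    then have "i \<in> {1..<2 * N}" using that by auto
    then show ?thesis using amp False by (simp add: piece_def max_def wave_at_next_node amplitudes_def)
  qed (simp add: piece_def wave_at_base)
  have left': "piece' i (node (Suc i)) = (if i = 0 then - (\<i> * k * U 1) else \<i> * ?\<kappa> i * W i)" for i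
    by (cases "i = 0")
      (simp_all add: piece'_def wave_at_base wave_at_next_node max_def W_def, simp add: wavenumber_def)
  have lim_right: "(u \<longlongrightarrow> U i) (at_right (node i))" "(u' \<longlongrightarrow> \<i> * ?\<kappa> i * V i) (at_right (node i))"
    if i: "i \<in> {1..2 * N}" for i
  proof -
    have f: "at (node i) within cell i = at_right (node i)" using i by (intro at_node_within_cell) auto
    note lim = tendsto_within_if_agrees_with_continuous[where S = "cell i" and p = "node i", unfolded f]
    show "(u \<longlongrightarrow> U i) (at_right (node i))" "(u' \<longlongrightarrow> \<i> * ?\<kappa> i * V i) (at_right (node i))"
      using lim[of "piece i" u] lim[of "piece' i" u'] u_cell[of i] right[of i] i
      by (auto simp: piece_def piece'_def wave_isCont)
  qed
  have lim_left: "(u \<longlongrightarrow> U (Suc i)) (at_left (node (Suc i)))"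
    "(u' \<longlongrightarrow> (if i = 0 then - (\<i> * k * U 1) else \<i> * ?\<kappa> i * W i)) (at_left (node (Suc i)))"
    if i: "i < 2 * N" for i
  proof -
    have f: "at (node (Suc i)) within cell i = at_left (node (Suc i))" using i by (rule at_node_Suc_within_cell)
    note lim = tendsto_within_if_agrees_with_continuous[where S = "cell i" and p = "node (Suc i)", unfolded f]
    show "(u \<longlongrightarrow> U (Suc i)) (at_left (node (Suc i)))"
      using lim[of "piece i" u] u_cell(1)[of i] left[of i] i by (simp add: piece_def wave_isCont)
    show "(u' \<longlongrightarrow> (if i = 0 then - (\<i> * k * U 1) else \<i> * ?\<kappa> i * W i)) (at_left (node (Suc i)))"
      using lim[of "piece' i" u'] u_cell(2)[of i] i unfolding left'[symmetric] by (simp add: piece'_def wave_isCont)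
  qed
  have "cellwise_solution r \<delta> k u u'"
    unfolding cellwise_solution_def
  proof (intro conjI allI impI ballI)
    fix i x assume i: "i \<le> 2 * N" and x: "x \<in> cell i"
    show "(u has_vector_derivative u' x) (at x)"
      using has_vector_derivative_transform_within_open[OF _ open_cell x, of "piece i" "u' x" u]
        wave_has_vector_derivative(1) u_cell[OF i] x by (simp add: piece_def piece'_def)
    show "(u' has_vector_derivative - ((?\<kappa> i)\<^sup>2 * u x)) (at x)"
      using has_vector_derivative_transform_within_open[OF _ open_cell x, of "piece' i" "- ((?\<kappa> i)\<^sup>2 * u x)" u']
        wave_has_vector_derivative(2) u_cell[OF i] x by (simp add: piece_def piece'_def)
  next
    fix i assume i: "i \<in> {1..2 * N}"
    then obtain n where n: "i = Suc n" "n < 2 * N" by (cases i) auto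
    show "has_traces u (node i) (u (node i)) (u (node i))"
      unfolding has_traces_def u_node[OF i] using lim_left(1)[OF n(2)] lim_right(1)[OF i] n by simp
    define L where "L = (if n = 0 then - (\<i> * k * U 1) else \<i> * ?\<kappa> n * W n)"
    have tr: "has_traces u' (node i) L (\<i> * ?\<kappa> i * V i)"
      unfolding has_traces_def L_def using lim_left(2)[OF n(2)] lim_right(2)[OF i] n by simp
    have jump: "if odd i then \<i> * ?\<kappa> i * V i = \<delta> * L else L = \<delta> * (\<i> * ?\<kappa> i * V i)"
    proof (cases "n = 0")
      case True
      then show ?thesis using amp n \<open>r > 0\<close> by (simp add: amplitudes_def L_def wavenumber_def)
    next
      case False
      then have "n \<in> {1..<2 * N}" using n by auto
      then have "if odd n then \<delta> / of_real r * V (Suc n) = W n else V (Suc n) = \<delta> / of_real r * W n"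
        unfolding W_def by (rule conjunct2[OF bspec[OF conjunct2[OF conjunct2[OF amp[unfolded amplitudes_def]]]]])
      then show ?thesis using False n \<open>r > 0\<close>
        by (auto simp: L_def wavenumber_def field_simps split: if_splits)
    qed
    then show "\<exists>a. has_traces u' (node i) (if odd i then a else \<delta> * a) (if odd i then \<delta> * a else a)"
      using tr by (intro exI[of _ "if odd i then L else \<i> * ?\<kappa> i * V i"]) (auto split: if_splits)
  next
    fix x assume "x \<in> cell 0"
    then show "u' x = - (\<i> * k * u x)"
      using u_cell[of 0 x] by (simp add: piece_def piece'_def wave_deriv_travelling wavenumber_def)
  next
    fix x assume "x \<in> cell (2 * N)"
    moreover have "V (2 * N) = U (2 * N)" using amp by (simp add: amplitudes_def)
    ultimately show "u' x = \<i> * k * u x"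
      using u_cell[of "2 * N" x] N_pos
      by (simp add: piece_def piece'_def wave_deriv_travelling wavenumber_def max_def)
  qed
  moreover have "u \<noteq> (\<lambda>x. 0)"
  proof
    assume u0: "u = (\<lambda>x. 0)"
    obtain i where i: "i \<in> {1..2 * N}" and nz: "U i \<noteq> 0 \<or> V i \<noteq> 0" using nontriv by (auto simp: nontrivial_def)
    have "U i = 0" using u_node[OF i] u0 by simp
    have f: "at (node i) within cell i = at_right (node i)" using i by (intro at_node_within_cell) auto
    have u'0: "u' x = 0" if "x \<in> cell i" for x
    proof -
      have "(u has_vector_derivative u' x) (at x)"
        using \<open>cellwise_solution r \<delta> k u u'\<close> i that by (auto simp: cellwise_solution_def)
      then show ?thesis unfolding u0 using vector_derivative_unique_at has_vector_derivative_const by blast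
    qed
    have "(u' \<longlongrightarrow> 0) (at_right (node i))"
      unfolding f[symmetric] by (rule tendsto_eventually) (auto simp: eventually_at_filter u'0)
    then have "\<i> * ?\<kappa> i * V i = 0"
      using tendsto_unique[OF trivial_limit_at_right_real lim_right(2)[OF i]] by blast
    then show False using nz \<open>U i = 0\<close> wavenumber_nonzero[of r k i] assms by simp
  qed
  ultimately show ?thesis by blast
qed

text \<open>
  The contrast seen by amplitudes is \<open>\<delta> / r\<close>, because derivatives in a resonator are
  measured relative to the wave number \<open>r * k\<close>.
\<close>

lemma resonance_iff_charpoly_zero:
  assumes "v > 0" "vb > 0" "k \<noteq> 0"
  defines "r \<equiv> v / vb"
  shows "resonance N xm xp v vb \<delta> (of_real v * k) \<longleftrightarrow>
    poly (charpoly (\<lambda>i. of_real (tvec r xm xp i) * k) (2 * N - 1)) (\<delta> / of_real r) = 0"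
proof -
  have "r > 0" using assms by simp
  have "resonance N xm xp v vb \<delta> (of_real v * k) \<longleftrightarrow>
      (\<exists>U V. amplitudes N (\<delta> / of_real r) (\<lambda>i. of_real (tvec r xm xp i) * k) U V \<and> nontrivial N U V)"
    unfolding resonance_def SP_solution_iff_cellwise[OF assms(1,2)] r_def[symmetric]
    using cellwise_solution_imp_amplitudes[OF _ \<open>r > 0\<close> \<open>k \<noteq> 0\<close>]
      amplitudes_imp_cellwise_solution[OF _ _ \<open>r > 0\<close> \<open>k \<noteq> 0\<close>] by blast
  then show ?thesis
    using amplitudes_imp_charpoly_zero[OF _ _ N_pos] charpoly_zero_imp_amplitudes[OF _ N_pos] by blast
qed

end

section \<open>Asymptotics of the resonances\<close>

lemma bigo_at_0_squareI:
  fixes f :: "complex \<Rightarrow> complex"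
  assumes "0 < \<epsilon>" "\<And>z. z \<in> ball 0 \<epsilon> \<Longrightarrow> norm (f z) \<le> K * norm z ^ 2"
  shows "f \<in> O[at 0](\<lambda>z. z\<^sup>2)"
proof (rule bigoI)
  have "\<forall>\<^sub>F z in at 0. z \<in> ball (0::complex) \<epsilon>"
    using assms(1) by (intro eventually_at_in_open') auto
  then show "\<forall>\<^sub>F z in at 0. norm (f z) \<le> K * norm (z\<^sup>2)"
    by eventually_elim (use assms(2) in \<open>simp add: norm_power\<close>)
qed

lemma bigo_at_infinity_inverse_squareI:
  fixes f :: "complex \<Rightarrow> complex"
  assumes "f \<in> O[at 0](\<lambda>z. z\<^sup>2)"
  shows "(\<lambda>z. f (inverse z)) \<in> O[at_infinity](\<lambda>z. (inverse z)\<^sup>2)"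
proof (rule landau_o.big.compose[OF assms])
  show "filterlim inverse (at (0::complex)) at_infinity"
    using eventually_not_equal_at_infinity[of "0::complex"]
    by (intro filterlim_atI tendsto_inverse_0) (auto elim: eventually_mono)
qed

context resonator_chain
begin

definition neighbour_cot :: "real \<Rightarrow> real \<Rightarrow> nat \<Rightarrow> complex" where
  "neighbour_cot r k0 i = (if i = 0 \<or> i = 2 * N then - \<i> else of_real (cot (tvec r xm xp i * k0)))"

lemma tvec_pos: "r > 0 \<Longrightarrow> i \<in> {1..2 * N - 1} \<Longrightarrow> tvec r xm xp i > 0"
  using resonator[of "(i + 1) div 2"] spacing[of "i div 2"]
  by (auto simp: tvec_def len_def gap_def elim!: evenE oddE)

text \<open>
  At \<open>k0 = 0\<close> all of the \<open>2 * N - 1\<close> intervals are resonant at the same time.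
\<close>

lemma nonzero_wavenumber_if_simple:
  assumes "nres N r xm xp k0 = 1" "N = 1 \<Longrightarrow> k0 \<noteq> 0"
  shows "k0 \<noteq> 0"
proof
  assume "k0 = 0"
  then have "{i \<in> {1..2 * N - 1}. pi_dvd (tvec r xm xp i * k0)} = {1..2 * N - 1}"
    by (auto simp: pi_dvd_def intro!: exI[of _ 0])
  then have "N = 1" using assms(1) by (simp add: nres_def)
  then show False using assms(2) \<open>k0 = 0\<close> by simp
qed

text \<open>
  A single function \<open>\<zeta>\<close> describes the resonances near \<open>k0 * v\<close> in both limits, with contrast
  \<open>\<delta> / r\<close> for small and, by duality, \<open>r / \<delta>\<close> for large \<open>\<delta>\<close>. The neighbourhood is chosen so small
  that it does not contain \<open>0\<close>, where the description by waves breaks down.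
\<close>

lemma resonance_branch:
  assumes v: "v > 0" "vb > 0" and r_def: "r = v / vb" and simple: "nres N r xm xp k0 = 1" and "k0 \<noteq> 0"
  obtains m \<rho> \<epsilon> \<zeta> where "m \<in> {1..2 * N - 1}"
    "\<And>i. i \<in> {1..2 * N - 1} \<Longrightarrow> pi_dvd (tvec r xm xp i * k0) \<longleftrightarrow> i = m"
    "0 < \<rho>" "0 < \<epsilon>" "\<zeta> holomorphic_on ball 0 \<epsilon>"
    "\<And>\<delta>. \<delta> / of_real r \<in> ball 0 \<epsilon> \<Longrightarrow>
       {w \<in> ball (of_real (k0 * v)) \<rho>. resonance N xm xp v vb \<delta> w} = {\<zeta> (\<delta> / of_real r)}"
    "\<And>\<delta>. \<delta> \<noteq> 0 \<Longrightarrow> of_real r / \<delta> \<in> ball 0 \<epsilon> \<Longrightarrow>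
       {w \<in> ball (of_real (k0 * v)) \<rho>. resonance N xm xp v vb \<delta> w} = {\<zeta> (of_real r / \<delta>)}"
    "(\<lambda>e. \<zeta> e - (of_real (k0 * v) + (neighbour_cot r k0 (m - 1) + neighbour_cot r k0 (m + 1))
        / of_real (tvec r xm xp m) * of_real v * e)) \<in> O[at 0](\<lambda>e. e\<^sup>2)"
proof -
  have "r > 0" using v r_def by simp
  define n where "n = 2 * N - 1"
  define \<theta> where "\<theta> z i = of_real (tvec r xm xp i) * z" for z :: complex and i
  have sin_iff: "pi_dvd x \<longleftrightarrow> sin x = 0" for x by (simp add: pi_dvd_def sin_zero_iff_int2 mult.commute)
  obtain m where "{i \<in> {1..n}. pi_dvd (tvec r xm xp i * k0)} = {m}"
    using simple by (auto simp: nres_def n_def card_1_singleton_iff)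
  then have m: "m \<in> {1..n}" and m_iff: "\<And>i. i \<in> {1..n} \<Longrightarrow> pi_dvd (tvec r xm xp i * k0) \<longleftrightarrow> i = m"
    by auto
  have tm: "tvec r xm xp m > 0" using tvec_pos \<open>r > 0\<close> m by (simp add: n_def)
  obtain \<rho> \<epsilon> \<xi> K where br: "0 < \<rho>" "\<rho> \<le> \<bar>k0\<bar>" "0 < \<epsilon>" "\<xi> holomorphic_on ball 0 \<epsilon>"
    "\<And>e z. e \<in> ball 0 \<epsilon> \<Longrightarrow> z \<in> ball (of_real k0) \<rho> \<Longrightarrow> poly (charpoly (\<theta> z) n) e = 0 \<longleftrightarrow> z = \<xi> e"
    "\<And>e. e \<in> ball 0 \<epsilon> \<Longrightarrow> \<xi> e \<in> ball (of_real k0) \<rho>"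
    "\<And>e. e \<in> ball 0 \<epsilon> \<Longrightarrow>
       norm (\<xi> e - (of_real k0 + (side_cot (\<theta> (of_real k0)) n (m - 1) + side_cot (\<theta> (of_real k0)) n (m + 1))
          / of_real (tvec r xm xp m) * e)) \<le> K * norm e ^ 2"
  proof (rule charpoly_root_branch[of m n "tvec r xm xp" k0 "\<bar>k0\<bar>"])
    show "1 \<le> m" "m \<le> n" "tvec r xm xp m \<noteq> 0" "0 < \<bar>k0\<bar>" using m tm \<open>k0 \<noteq> 0\<close> by auto
    show "sin (tvec r xm xp m * k0) = 0" using m_iff[OF m] by (simp add: sin_iff)
    show "sin (tvec r xm xp j * k0) \<noteq> 0" if "1 \<le> j" "j \<le> n" "j \<noteq> m" for j
      using m_iff[of j] that by (simp add: sin_iff)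
  qed (unfold \<theta>_def, blast)
  define \<zeta> where "\<zeta> e = of_real v * \<xi> e" for e
  have in_ball: "w \<in> ball (of_real (k0 * v)) (v * \<rho>) \<longleftrightarrow> w / of_real v \<in> ball (of_real k0) \<rho>" for w :: complex
  proof -
    have "of_real (k0 * v) - w = of_real v * (of_real k0 - w / of_real v)" using v by (simp add: field_simps)
    then have "norm (of_real (k0 * v) - w) = v * norm (of_real k0 - w / of_real v)"
      using v by (simp add: norm_mult)
    then show ?thesis using v by (simp add: dist_norm)
  qed
  have res: "{w \<in> ball (of_real (k0 * v)) (v * \<rho>). resonance N xm xp v vb \<delta> w} = {\<zeta> e}"
    if e: "e \<in> ball 0 \<epsilon>"
      and zero_iff: "\<And>z. poly (charpoly (\<theta> z) n) (\<delta> / of_real r) = 0 \<longleftrightarrow> poly (charpoly (\<theta> z) n) e = 0" for \<delta> e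
  proof -
    have "w \<in> ball (of_real (k0 * v)) (v * \<rho>) \<and> resonance N xm xp v vb \<delta> w \<longleftrightarrow> w = \<zeta> e" for w
    proof (cases "w / of_real v \<in> ball (of_real k0) \<rho>")
      case True
      have "w / of_real v \<noteq> 0" using True br(2) by auto
      then have "resonance N xm xp v vb \<delta> (of_real v * (w / of_real v)) \<longleftrightarrow>
          poly (charpoly (\<theta> (w / of_real v)) n) (\<delta> / of_real r) = 0"
        using resonance_iff_charpoly_zero[OF v, of "w / of_real v" \<delta>] unfolding \<theta>_def n_def r_def by blast
      then have "resonance N xm xp v vb \<delta> w \<longleftrightarrow> w / of_real v = \<xi> e"
        using v zero_iff br(5)[OF e True] by simp
      then show ?thesis using v True in_ball by (auto simp: \<zeta>_def field_simps)
    next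
      case False
      then show ?thesis using in_ball[of w] br(6)[OF e] v by (auto simp: \<zeta>_def)
    qed
    then show ?thesis by blast
  qed
  have cot: "side_cot (\<theta> (of_real k0)) n i = neighbour_cot r k0 i" for i
    using N_pos by (auto simp: side_cot_def neighbour_cot_def n_def \<theta>_def cot_def
        simp flip: of_real_mult sin_of_real cos_of_real)
  have asym: "norm (\<zeta> e - (of_real (k0 * v) + (neighbour_cot r k0 (m - 1) + neighbour_cot r k0 (m + 1))
        / of_real (tvec r xm xp m) * of_real v * e)) \<le> (v * K) * norm e ^ 2" if "e \<in> ball 0 \<epsilon>" for e
  proof -
    define c where "c = (neighbour_cot r k0 (m - 1) + neighbour_cot r k0 (m + 1)) / of_real (tvec r xm xp m)"
    have "norm (of_real v * (\<xi> e - (of_real k0 + c * e))) \<le> v * (K * norm e ^ 2)"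
      using br(7)[OF that] v unfolding cot c_def by (simp add: norm_mult)
    also have "of_real v * (\<xi> e - (of_real k0 + c * e)) = \<zeta> e - (of_real (k0 * v) + c * of_real v * e)"
      by (simp add: \<zeta>_def algebra_simps)
    finally show ?thesis unfolding c_def by (simp only: mult.assoc)
  qed
  show thesis
  proof (rule that[of m "v * \<rho>" \<epsilon> \<zeta>])
    show "\<zeta> holomorphic_on ball 0 \<epsilon>" unfolding \<zeta>_def[abs_def] by (intro holomorphic_intros br)
    show "{w \<in> ball (of_real (k0 * v)) (v * \<rho>). resonance N xm xp v vb \<delta> w} = {\<zeta> (\<delta> / of_real r)}"
      if "\<delta> / of_real r \<in> ball 0 \<epsilon>" for \<delta> using that by (rule res) simp
    show "{w \<in> ball (of_real (k0 * v)) (v * \<rho>). resonance N xm xp v vb \<delta> w} = {\<zeta> (of_real r / \<delta>)}"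
      if "\<delta> \<noteq> 0" "of_real r / \<delta> \<in> ball 0 \<epsilon>" for \<delta>
      using that(2)
    proof (rule res)
      have "of_real r / \<delta> \<noteq> 0" "inverse (of_real r / \<delta>) = \<delta> / of_real r" using \<open>r > 0\<close> that by auto
      then show "poly (charpoly (\<theta> z) n) (\<delta> / of_real r) = 0 \<longleftrightarrow> poly (charpoly (\<theta> z) n) (of_real r / \<delta>) = 0" for z
        using charpoly_inverse_zero_iff by metis
    qed
    show "(\<lambda>e. \<zeta> e - (of_real (k0 * v) + (neighbour_cot r k0 (m - 1) + neighbour_cot r k0 (m + 1))
        / of_real (tvec r xm xp m) * of_real v * e)) \<in> O[at 0](\<lambda>e. e\<^sup>2)"
      using br(3) asym by (rule bigo_at_0_squareI)
  qed (use m m_iff br v in \<open>auto simp: n_def\<close>)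
qed

end

lemma bigo_at_0_square_scale:
  fixes f :: "complex \<Rightarrow> complex"
  assumes "f \<in> O[at 0](\<lambda>z. z\<^sup>2)" "a \<noteq> 0"
  shows "(\<lambda>z. f (a * z)) \<in> O[at 0](\<lambda>z. z\<^sup>2)"
proof -
  have "((\<lambda>z. a * z) \<longlongrightarrow> a * 0) (at 0)" by (intro tendsto_intros)
  then have "filterlim (\<lambda>z. a * z) (at 0) (at 0)"
    using assms(2) by (intro filterlim_atI) (auto simp: eventually_at_filter)
  from landau_o.big.compose[OF assms(1) this]
  show ?thesis using assms(2) by (simp add: power_mult_distrib)
qed

lemma analytic_on_ball_scale:
  assumes "f holomorphic_on ball 0 \<epsilon>" "0 < a"
  shows "(\<lambda>z. f (of_real a * z)) analytic_on ball 0 (\<epsilon> / a)"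
proof -
  have "(f \<circ> (\<lambda>z. of_real a * z)) holomorphic_on ball 0 (\<epsilon> / a)"
    using assms by (intro holomorphic_on_compose_gen[where t = "ball 0 \<epsilon>"] holomorphic_intros)
      (auto simp: norm_mult field_simps)
  then show ?thesis by (simp add: analytic_on_open o_def)
qed

theorem theorem3p7:
  fixes N :: nat and xm xp :: "nat \<Rightarrow> real" and v vb r k0 :: real and l s :: "nat \<Rightarrow> real"
  assumes "N \<ge> 1"
    and "\<And>j. 1 \<le> j \<Longrightarrow> j \<le> N \<Longrightarrow> xm j < xp j"
    and "\<And>j. 1 \<le> j \<Longrightarrow> j < N \<Longrightarrow> xp j < xm (j + 1)"
    and "v > 0" and "vb > 0"
    and "r = v / vb" and "l = len xm xp" and "s = gap xm xp"
    and "nres N r xm xp k0 = 1"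
    and "N = 1 \<Longrightarrow> k0 \<noteq> 0"
  shows
    "(\<exists>U \<epsilon>. \<exists>\<omega> :: complex \<Rightarrow> complex.
        open U \<and> of_real (k0 * v) \<in> U \<and> 0 < \<epsilon> \<and> \<omega> analytic_on ball 0 \<epsilon> \<and>
        (\<forall>\<delta>. norm \<delta> < \<epsilon> \<longrightarrow> {w \<in> U. resonance N xm xp v vb \<delta> w} = {\<omega> \<delta>}) \<and>
        (2 \<le> N \<and> pi_dvd (r * l 1 * k0) \<longrightarrow>
          (\<lambda>\<delta>. \<omega> \<delta> - (of_real (k0 * v) + ((of_real (cot (s 1 * k0)) - \<i>) / of_real (r\<^sup>2 * l 1)) * of_real v * \<delta>)) \<in> O[at 0](\<lambda>\<delta>. \<delta>\<^sup>2)) \<and>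
        (2 \<le> N \<and> pi_dvd (r * l N * k0) \<longrightarrow>
          (\<lambda>\<delta>. \<omega> \<delta> - (of_real (k0 * v) + ((of_real (cot (s (N - 1) * k0)) - \<i>) / of_real (r\<^sup>2 * l N)) * of_real v * \<delta>)) \<in> O[at 0](\<lambda>\<delta>. \<delta>\<^sup>2)) \<and>
        (\<forall>j. 1 < j \<and> j < N \<and> pi_dvd (r * l j * k0) \<longrightarrow>
          (\<lambda>\<delta>. \<omega> \<delta> - (of_real (k0 * v) + (of_real (cot (s (j - 1) * k0) + cot (s j * k0)) / of_real (r\<^sup>2 * l j)) * of_real v * \<delta>)) \<in> O[at 0](\<lambda>\<delta>. \<delta>\<^sup>2)) \<and>
        (\<forall>j. 1 \<le> j \<and> j \<le> N - 1 \<and> pi_dvd (s j * k0) \<longrightarrow>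
          (\<lambda>\<delta>. \<omega> \<delta> - (of_real (k0 * v) + (of_real (cot (r * l j * k0) + cot (r * l (j + 1) * k0)) / of_real (r * s j)) * of_real v * \<delta>)) \<in> O[at 0](\<lambda>\<delta>. \<delta>\<^sup>2)))
   \<and> (\<exists>U \<epsilon>. \<exists>\<omega> :: complex \<Rightarrow> complex.
        open U \<and> of_real (k0 * v) \<in> U \<and> 0 < \<epsilon> \<and> \<omega> analytic_on ball 0 \<epsilon> \<and>
        (\<forall>\<delta>. norm \<delta> > inverse \<epsilon> \<longrightarrow> {w \<in> U. resonance N xm xp v vb \<delta> w} = {\<omega> (inverse \<delta>)}) \<and>
        (2 \<le> N \<and> pi_dvd (r * l 1 * k0) \<longrightarrow>
          (\<lambda>\<delta>. \<omega> (inverse \<delta>) - (of_real (k0 * v) + ((of_real (cot (s 1 * k0)) - \<i>) / of_real (l 1)) * of_real v / \<delta>)) \<in> O[at_infinity](\<lambda>\<delta>. inverse \<delta> ^ 2)) \<and>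
        (2 \<le> N \<and> pi_dvd (r * l N * k0) \<longrightarrow>
          (\<lambda>\<delta>. \<omega> (inverse \<delta>) - (of_real (k0 * v) + ((of_real (cot (s (N - 1) * k0)) - \<i>) / of_real (l N)) * of_real v / \<delta>)) \<in> O[at_infinity](\<lambda>\<delta>. inverse \<delta> ^ 2)) \<and>
        (\<forall>j. 1 < j \<and> j < N \<and> pi_dvd (r * l j * k0) \<longrightarrow>
          (\<lambda>\<delta>. \<omega> (inverse \<delta>) - (of_real (k0 * v) + (of_real (cot (s (j - 1) * k0) + cot (s j * k0)) / of_real (l j)) * of_real v / \<delta>)) \<in> O[at_infinity](\<lambda>\<delta>. inverse \<delta> ^ 2)) \<and>
        (\<forall>j. 1 \<le> j \<and> j \<le> N - 1 \<and> pi_dvd (s j * k0) \<longrightarrow>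
          (\<lambda>\<delta>. \<omega> (inverse \<delta>) - (of_real (k0 * v) + (of_real (cot (r * l j * k0) + cot (r * l (j + 1) * k0)) / of_real (s j)) * of_real r * of_real v / \<delta>)) \<in> O[at_infinity](\<lambda>\<delta>. inverse \<delta> ^ 2)))"
proof -
  interpret resonator_chain N xm xp by unfold_locales (use assms(1-3) in auto)
  have "r > 0" using assms(4-6) by simp
  have "k0 \<noteq> 0" using nonzero_wavenumber_if_simple[OF assms(9,10)] .
  obtain m \<rho> \<epsilon> \<zeta> where m: "m \<in> {1..2 * N - 1}"
    "\<And>i. i \<in> {1..2 * N - 1} \<Longrightarrow> pi_dvd (tvec r xm xp i * k0) \<longleftrightarrow> i = m"
    and pos: "0 < \<rho>" "0 < \<epsilon>" and hol: "\<zeta> holomorphic_on ball 0 \<epsilon>"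
    and res0: "\<And>\<delta>. \<delta> / of_real r \<in> ball 0 \<epsilon> \<Longrightarrow>
       {w \<in> ball (of_real (k0 * v)) \<rho>. resonance N xm xp v vb \<delta> w} = {\<zeta> (\<delta> / of_real r)}"
    and resI: "\<And>\<delta>. \<delta> \<noteq> 0 \<Longrightarrow> of_real r / \<delta> \<in> ball 0 \<epsilon> \<Longrightarrow>
       {w \<in> ball (of_real (k0 * v)) \<rho>. resonance N xm xp v vb \<delta> w} = {\<zeta> (of_real r / \<delta>)}"
    and asym: "(\<lambda>e. \<zeta> e - (of_real (k0 * v) + (neighbour_cot r k0 (m - 1) + neighbour_cot r k0 (m + 1))
        / of_real (tvec r xm xp m) * of_real v * e)) \<in> O[at 0](\<lambda>e. e\<^sup>2)"
    using resonance_branch[OF assms(4-6,9) \<open>k0 \<noteq> 0\<close>] by blast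
  \<comment> \<open>The slope of the branch, divided by \<open>v\<close>.\<close>
  define C where "C = (neighbour_cot r k0 (m - 1) + neighbour_cot r k0 (m + 1)) / of_real (tvec r xm xp m)"
  have tvec_l: "tvec r xm xp (2 * j - 1) = r * l j" if "1 \<le> j" for j
    using that by (auto simp: tvec_def assms(7))
  have tvec_s: "tvec r xm xp (2 * j) = s j" for j by (simp add: tvec_def assms(8))
  have C_first: "C = (of_real (cot (s 1 * k0)) - \<i>) / of_real (r * l 1)" if "2 \<le> N" "pi_dvd (r * l 1 * k0)"
  proof -
    have "m = 1" using m(2)[of 1] tvec_l[of 1] that by simp
    moreover have "tvec r xm xp (Suc (Suc 0)) = s 1" using tvec_s[of 1] by (simp add: numeral_2_eq_2)
    ultimately show ?thesis using that tvec_l[of 1] by (simp add: C_def neighbour_cot_def)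
  qed
  have C_last: "C = (of_real (cot (s (N - 1) * k0)) - \<i>) / of_real (r * l N)" if "2 \<le> N" "pi_dvd (r * l N * k0)"
  proof -
    have "m = 2 * N - 1" using m(2)[of "2 * N - 1"] tvec_l[of N] that by simp
    moreover have "2 * N - 1 - 1 = 2 * (N - 1)" "2 * N - 1 + 1 = 2 * N" "N - 1 \<noteq> N" using that by simp_all
    ultimately show ?thesis using that tvec_l[of N] tvec_s[of "N - 1"] by (simp add: C_def neighbour_cot_def)
  qed
  have C_resonator: "C = of_real (cot (s (j - 1) * k0) + cot (s j * k0)) / of_real (r * l j)"
    if "1 < j" "j < N" "pi_dvd (r * l j * k0)" for j
  proof -
    have "2 * j - 1 \<in> {1..2 * N - 1}" unfolding atLeastAtMost_iff using that by presburger
    then have "m = 2 * j - 1" using m(2)[of "2 * j - 1"] tvec_l[of j] that by simp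
    moreover have "2 * j - 1 - 1 = 2 * (j - 1)" "2 * j - 1 + 1 = 2 * j" "j - 1 \<noteq> N" using that by simp_all
    ultimately show ?thesis using that tvec_l[of j] tvec_s[of "j - 1"] tvec_s[of j]
      by (simp add: C_def neighbour_cot_def)
  qed
  have C_gap: "C = of_real (cot (r * l j * k0) + cot (r * l (j + 1) * k0)) / of_real (s j)"
    if "1 \<le> j" "j \<le> N - 1" "pi_dvd (s j * k0)" for j
  proof -
    have "2 * j \<in> {1..2 * N - 1}" unfolding atLeastAtMost_iff using that by presburger
    then have "m = 2 * j" using m(2)[of "2 * j"] tvec_s[of j] that by simp
    moreover have "tvec r xm xp (2 * j + 1) = r * l (j + 1)" using tvec_l[of "j + 1"] by simp
    moreover have "2 * j - 1 \<noteq> 0" "2 * j - 1 \<noteq> 2 * N" "2 * j + 1 \<noteq> 2 * N" using that by presburger+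
    ultimately show ?thesis using tvec_l[of j] tvec_s[of j] that(1)
      unfolding C_def neighbour_cot_def by simp
  qed
  define \<omega>0 where "\<omega>0 \<delta> = \<zeta> (of_real (inverse r) * \<delta>)" for \<delta>
  define \<omega>I where "\<omega>I \<mu> = \<zeta> (of_real r * \<mu>)" for \<mu>
  have asym0: "(\<lambda>\<delta>. \<omega>0 \<delta> - (of_real (k0 * v) + c * of_real v * \<delta>)) \<in> O[at 0](\<lambda>\<delta>. \<delta>\<^sup>2)"
    if "c = C / of_real r" for c
    using bigo_at_0_square_scale[OF asym, of "of_real (inverse r)"] \<open>r > 0\<close>
    unfolding \<omega>0_def that C_def[symmetric] by (simp add: field_simps)
  have asymI: "(\<lambda>\<delta>. \<omega>I (inverse \<delta>) - (of_real (k0 * v) + c * of_real v / \<delta>)) \<in> O[at_infinity](\<lambda>\<delta>. inverse \<delta> ^ 2)"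
    if "c = of_real r * C" for c
  proof -
    have "(\<lambda>\<mu>. \<omega>I \<mu> - (of_real (k0 * v) + c * of_real v * \<mu>)) \<in> O[at 0](\<lambda>\<mu>. \<mu>\<^sup>2)"
      using bigo_at_0_square_scale[OF asym, of "of_real r"] \<open>r > 0\<close>
      unfolding \<omega>I_def that C_def[symmetric] by (simp add: mult_ac)
    from bigo_at_infinity_inverse_squareI[OF this] show ?thesis by (simp add: divide_inverse)
  qed
  have an0: "\<omega>0 analytic_on ball 0 (\<epsilon> / inverse r)"
    unfolding \<omega>0_def[abs_def] using \<open>r > 0\<close> by (intro analytic_on_ball_scale hol) simp
  have anI: "\<omega>I analytic_on ball 0 (\<epsilon> / r)"
    unfolding \<omega>I_def[abs_def] using \<open>r > 0\<close> by (intro analytic_on_ball_scale hol)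
  have sol0: "{w \<in> ball (of_real (k0 * v)) \<rho>. resonance N xm xp v vb \<delta> w} = {\<omega>0 \<delta>}"
    if "norm \<delta> < \<epsilon> / inverse r" for \<delta>
  proof -
    have "\<delta> / of_real r \<in> ball 0 \<epsilon>" using that \<open>r > 0\<close> by (simp add: norm_divide field_simps)
    then show ?thesis using res0[of \<delta>] by (simp add: \<omega>0_def divide_inverse mult.commute)
  qed
  have solI: "{w \<in> ball (of_real (k0 * v)) \<rho>. resonance N xm xp v vb \<delta> w} = {\<omega>I (inverse \<delta>)}"
    if "norm \<delta> > inverse (\<epsilon> / r)" for \<delta>
  proof -
    have "inverse (\<epsilon> / r) > 0" using pos \<open>r > 0\<close> by simp
    then have "\<delta> \<noteq> 0" using that by auto
    moreover have "of_real r / \<delta> \<in> ball 0 \<epsilon>"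
      using that \<open>r > 0\<close> pos \<open>\<delta> \<noteq> 0\<close> by (simp add: norm_divide field_simps)
    ultimately show ?thesis using resI[of \<delta>] by (simp add: \<omega>I_def divide_inverse)
  qed
  show ?thesis
    apply (rule conjI)
    subgoal
      apply (intro exI[of _ "ball (of_real (k0 * v)) \<rho>"] exI[of _ "\<epsilon> / inverse r"] exI[of _ \<omega>0] conjI allI impI)
      subgoal by simp
      subgoal using pos by simp
      subgoal using pos \<open>r > 0\<close> by simp
      subgoal by (rule an0)
      subgoal by (rule sol0)
      subgoal using \<open>r > 0\<close> by (intro asym0) (simp add: C_first power2_eq_square mult_ac)
      subgoal using \<open>r > 0\<close> by (intro asym0) (simp add: C_last power2_eq_square mult_ac)
      subgoal for j using \<open>r > 0\<close> by (intro asym0) (simp add: C_resonator[of j] power2_eq_square mult_ac)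
      subgoal for j using \<open>r > 0\<close> by (intro asym0) (simp add: C_gap[of j] power2_eq_square mult_ac)
      done
    subgoal
      apply (intro exI[of _ "ball (of_real (k0 * v)) \<rho>"] exI[of _ "\<epsilon> / r"] exI[of _ \<omega>I] conjI allI impI)
      subgoal by simp
      subgoal using pos by simp
      subgoal using pos \<open>r > 0\<close> by simp
      subgoal by (rule anI)
      subgoal by (rule solI)
      subgoal using \<open>r > 0\<close> by (intro asymI) (simp add: C_first)
      subgoal using \<open>r > 0\<close> by (intro asymI) (simp add: C_last)
      subgoal for j using \<open>r > 0\<close> by (intro asymI) (simp add: C_resonator[of j])
      subgoal for j using \<open>r > 0\<close> by (intro asymI) (simp add: C_gap[of j])
      done
    done
qed

end
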